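(* Let $a,b$ be integers with $1\le a\le b$, let $U$ be a sufficiently small open neighborhood of the origin in $\mathbb{R}^2$, and let $f:U\to\mathbb{R}$ be a smooth function of the form $$f(x,y)=v(x,y)\,x^a y^b+h(x,y),\qquad h(x,y)=\sum_{j=0}^{a-1}x^j h_j(y),$$ where $v$ is a real-valued smooth function on $U$ with $v(0,0)>0$, each $h_j$ is a real-valued smooth function of one variable flat at the origin, and $h$ is not identically zero. Then, if the support of the real-valued function $\varphi\in C_0^\infty(U)$ is sufficiently small (i.e. contained in a sufficiently small neighborhood of the origin, depending on $f$), the function $$Z_f(\varphi)(s)=\int_{\mathbb{R}^2}|f(x,y)|^s\varphi(x,y)\,dx\,dy,$$ which is holomorphic on $\mathrm{Re}(s)>0$, can be analytically continued as a meromorphic function to the half-plane $\mathrm{Re}(s)>-1/a$. Moreover, when $a<b$, its poles on the region $\mathrm{Re}(s)>-1/a$ are contained in the set $\{-k/b: k\in\mathbb{N},\ k<b/a\}$. In particular, $m_0(f)\ge 1/a$ holds.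
   Context: Smooth means $C^\infty$; $\mathbb{N}=\{1,2,3,\dots\}$. A smooth function defined near the origin is flat at the origin if all its derivatives (of all orders, including order zero) vanish at the origin. $C_0^\infty(U)$ is the set of smooth functions with compact support in $U$. For $\varphi\in C_0^\infty(U)$ let $m_0(f,\varphi)$ be the supremum of all $\rho>0$ such that $Z_f(\varphi)$ can be meromorphically continued to a domain containing the half-plane $\mathrm{Re}(s)>-\rho$, and let $m_0(f)=\inf\{m_0(f,\varphi):\varphi\in C_0^\infty(U)\}$, where the neighborhood $U$ of the origin is understood to be sufficiently small. *)

theory Defs
  imports "HOL-Complex_Analysis.Complex_Analysis"
begin

text \<open>\<open>dir_derivs [v\<^sub>1, \<dots>, v\<^sub>n] f\<close> is the iterated directional derivative
  \<open>\<partial>\<^sub>v\<^sub>n \<dots> \<partial>\<^sub>v\<^sub>1 f\<close>; on the real line the directions are scalars.\<close>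

fun dir_derivs ::
  "'a list \<Rightarrow> ('a::real_normed_vector \<Rightarrow> 'b::real_normed_vector) \<Rightarrow> 'a \<Rightarrow> 'b" where
  "dir_derivs [] f = f"
| "dir_derivs (v # vs) f = dir_derivs vs (\<lambda>x. frechet_derivative f (at x) v)"

text \<open>On an open subset \<open>S\<close> of a finite-dimensional space this is \<open>f \<in> C\<^sup>\<infinity>(S)\<close>: all
  iterated directional derivatives are differentiable, hence exist and are continuous on \<open>S\<close>.
  The values of \<open>f\<close> outside \<open>S\<close> are irrelevant.\<close>

definition smooth_on ::
  "'a::real_normed_vector set \<Rightarrow> ('a \<Rightarrow> 'b::real_normed_vector) \<Rightarrow> bool" where
  "smooth_on S f \<longleftrightarrow> (\<forall>vs. \<forall>x\<in>S. dir_derivs vs f differentiable (at x))"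

text \<open>Meaningful for \<open>f\<close> smooth near the origin; the empty list gives \<open>f 0 = 0\<close>.\<close>

definition flat_at_origin ::
  "('a::real_normed_vector \<Rightarrow> 'b::real_normed_vector) \<Rightarrow> bool" where
  "flat_at_origin f \<longleftrightarrow> (\<forall>vs. dir_derivs vs f 0 = 0)"

text \<open>The real-valued functions in \<open>C\<^sub>0\<^sup>\<infinity>(U)\<close>, extended by zero to the whole plane.\<close>

definition test_functions :: "(real \<times> real) set \<Rightarrow> (real \<times> real \<Rightarrow> real) set" where
  "test_functions U = {\<phi>. smooth_on UNIV \<phi> \<and>
     compact (closure {p. \<phi> p \<noteq> 0}) \<and> closure {p. \<phi> p \<noteq> 0} \<subseteq> U}"

text \<open>\<open>f\<close> only matters on the support of \<open>\<phi>\<close>. For \<open>Re s > 0\<close> the convention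
  \<open>0 powr s = 0\<close> agrees with \<open>\<bar>f\<bar>\<^sup>s = 0\<close> on the zero set of \<open>f\<close>.\<close>

definition zeta_integrand ::
  "(real \<times> real \<Rightarrow> real) \<Rightarrow> (real \<times> real \<Rightarrow> real) \<Rightarrow> complex \<Rightarrow> real \<times> real \<Rightarrow> complex" where
  "zeta_integrand f \<phi> s p = complex_of_real \<bar>f p\<bar> powr s * complex_of_real (\<phi> p)"

definition local_zeta ::
  "(real \<times> real \<Rightarrow> real) \<Rightarrow> (real \<times> real \<Rightarrow> real) \<Rightarrow> complex \<Rightarrow> complex" where
  "local_zeta f \<phi> s = (\<integral>p. zeta_integrand f \<phi> s p \<partial>lborel)"

text \<open>\<open>nicely_meromorphic_on\<close> (rather than \<open>meromorphic_on\<close>) makes \<open>F\<close> holomorphic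
  at every point of \<open>D\<close> that is not a pole.\<close>

definition meromorphic_continuation ::
  "(complex \<Rightarrow> complex) \<Rightarrow> complex set \<Rightarrow> (complex \<Rightarrow> complex) \<Rightarrow> bool" where
  "meromorphic_continuation Z D F \<longleftrightarrow>
     open D \<and> connected D \<and> {s. Re s > 0} \<subseteq> D \<and>
     F nicely_meromorphic_on D \<and> (\<forall>s. Re s > 0 \<longrightarrow> F s = Z s)"

definition m0_at ::
  "(real \<times> real \<Rightarrow> real) \<Rightarrow> (real \<times> real \<Rightarrow> real) \<Rightarrow> ereal" where
  "m0_at f \<phi> = Sup {ereal \<rho> | \<rho>. \<rho> > 0 \<and>
     (\<exists>D F. {s. Re s > - \<rho>} \<subseteq> D \<and> meromorphic_continuation (local_zeta f \<phi>) D F)}"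

text \<open>The neighbourhood \<open>U\<close> of the origin is kept as an explicit parameter.\<close>

definition m0 :: "(real \<times> real \<Rightarrow> real) \<Rightarrow> (real \<times> real) set \<Rightarrow> ereal" where
  "m0 f U = (INF \<phi>\<in>test_functions U. m0_at f \<phi>)"

end

theory Submission
  imports Defs
begin

text \<open>Write \<open>g(x,y) = v(x,y) x\<^sup>a y\<^sup>b\<close>, so that \<open>f = g + h\<close> with \<open>h\<close> flat in \<open>y\<close>, and let \<open>H\<close> be the
half-plane \<open>Re s > -1/a\<close>.  The perturbation \<open>h\<close> contributes nothing singular on \<open>H\<close>: the idea is
to show that \<open>Z\<^sub>f - Z\<^sub>g\<close> extends holomorphically to \<open>H\<close>, and to continue \<open>Z\<^sub>g\<close>
by integrating by parts in \<open>y\<close>.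

The estimate behind everything is of van der Corput type.  Since the \<open>x\<close>-degree of \<open>h\<close> is less
than \<open>a\<close>, the derivative \<open>\<partial>\<^sub>x\<^sup>a f\<close> equals \<open>y\<^sup>b \<partial>\<^sub>x\<^sup>a (x\<^sup>a v)\<close>, and the second factor has the value
\<open>a! v(0,0) > 0\<close> at the origin.  Hence, on a small square, \<open>\<bar>\<partial>\<^sub>x\<^sup>a f\<bar> \<ge> c \<bar>y\<bar>\<^sup>b\<close>, and the same
holds for \<open>g\<close>.  A lower bound \<open>\<lambda>\<close> on the \<open>a\<close>-th derivative forces the set where the function is
at most \<open>\<epsilon>\<close> to have measure \<open>O((\<epsilon>/\<lambda>)\<^bsup>1/a\<^esup>)\<close>, so that
\<open>\<integral> \<bar>f(x,y)\<bar>\<^sup>\<tau> dx \<le> C \<bar>y\<bar>\<^bsup>b\<tau>\<^esup>\<close> for \<open>-1/a < \<tau> < 0\<close>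
(\<open>nn_integral_powr_van_der_Corput\<close>).

For the difference, the elementary inequality
\<open>\<bar>A\<^sup>s - B\<^sup>s\<bar> \<le> (2 + \<bar>s\<bar>) \<bar>A - B\<bar>\<^sup>\<theta> (A\<^bsup>Re s - \<theta>\<^esup> + B\<^bsup>Re s - \<theta>\<^esup>)\<close>
(\<open>norm_powr_diff_le\<close>) is applied to \<open>A = \<bar>f\<bar>\<close>, \<open>B = \<bar>g\<bar>\<close> with \<open>\<theta> > 0\<close> so small that
\<open>Re s - \<theta> > -1/a\<close>.  The factor \<open>\<bar>h\<bar>\<^sup>\<theta>\<close> is \<open>O(\<bar>y\<bar>\<^sup>n)\<close> for every \<open>n\<close> and absorbs the
singularity \<open>\<bar>y\<bar>\<^bsup>b(Re s - \<theta>)\<^esup>\<close>; this gives an integrable majorant, locally uniformly in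
\<open>s \<in> H\<close> (\<open>zeta_difference_holomorphic\<close>).

For \<open>g\<close> itself, let \<open>I\<^sub>k(\<phi>)\<close> be the zeta integral of \<open>g\<close> against \<open>y\<^sup>k \<phi>\<close>.  Integration by parts in \<open>y\<close>
yields \<open>(b s + k + 1) I\<^sub>k(\<phi>) = -(s I\<^bsub>k+1\<^esub>(\<phi> v\<^sub>y / v) + I\<^bsub>k+1\<^esub>(\<phi>\<^sub>y))\<close> for \<open>Re s > 0\<close>
(\<open>local_zeta_integration_by_parts\<close>), while \<open>I\<^sub>N\<close> converges on all of \<open>H\<close> as soon as
\<open>N + 1 \<ge> b/a\<close>.  With \<open>N = (b - 1) div a\<close>, which is the number of \<open>k \<ge> 1\<close> with \<open>k < b/a\<close>, it follows that
\<open>\<Prod>\<^bsub>1\<le>j\<le>N\<^esub> (b s + j) Z\<^sub>g(s)\<close> extends holomorphically to \<open>H\<close> (\<open>monomial_zeta_numerator\<close>), and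
the zeros of the product are the only possible poles.\<close>

section \<open>Smooth functions\<close>

definition directional_derivative ::
  "('a::real_normed_vector \<Rightarrow> 'b::real_normed_vector) \<Rightarrow> 'a \<Rightarrow> 'a \<Rightarrow> 'b" where
  "directional_derivative f v = (\<lambda>x. frechet_derivative f (at x) v)"

text \<open>Smoothness is a condition on all lists of directions at once, which does not allow an induction
for products: a derivative of \<open>f g\<close> is a sum of products of other functions.  Counting the order
instead makes the product rule the induction step.\<close>

primrec smooth_of_order ::
  "nat \<Rightarrow> 'a::real_normed_vector set \<Rightarrow> ('a \<Rightarrow> 'b::real_normed_vector) \<Rightarrow> bool" where
  "smooth_of_order 0 S f \<longleftrightarrow> (\<forall>x\<in>S. f differentiable (at x))"
| "smooth_of_order (Suc n) S f \<longleftrightarrow>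
     (\<forall>x\<in>S. f differentiable (at x)) \<and> (\<forall>v. smooth_of_order n S (directional_derivative f v))"

lemma smooth_of_order_iff:
  "smooth_of_order n S f \<longleftrightarrow>
     (\<forall>vs. length vs \<le> n \<longrightarrow> (\<forall>x\<in>S. dir_derivs vs f differentiable (at x)))"
proof (induction n arbitrary: f)
  case (Suc n)
  have split: "(\<forall>vs. length vs \<le> Suc n \<longrightarrow> P vs) \<longleftrightarrow>
      P [] \<and> (\<forall>v vs. length vs \<le> n \<longrightarrow> P (v # vs))" for P :: "'a list \<Rightarrow> bool"
    by (metis Suc_le_mono length_Cons list.exhaust list.size(3) zero_le)
  show ?case
    by (subst split) (simp add: Suc directional_derivative_def)
qed simp

lemma smooth_on_iff_all_orders: "smooth_on S f \<longleftrightarrow> (\<forall>n. smooth_of_order n S f)"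
  unfolding smooth_on_def smooth_of_order_iff by blast

lemma smooth_of_order_imp_differentiable:
  "smooth_of_order n S f \<Longrightarrow> x \<in> S \<Longrightarrow> f differentiable (at x)"
  by (cases n) auto

lemma smooth_of_order_Suc_imp: "smooth_of_order (Suc n) S f \<Longrightarrow> smooth_of_order n S f"
  unfolding smooth_of_order_iff by auto

lemma smooth_on_imp_differentiable: "smooth_on S f \<Longrightarrow> x \<in> S \<Longrightarrow> f differentiable (at x)"
  unfolding smooth_on_iff_all_orders using smooth_of_order_imp_differentiable by blast

lemma smooth_on_subset: "smooth_on S f \<Longrightarrow> T \<subseteq> S \<Longrightarrow> smooth_on T f"
  unfolding smooth_on_def by blast

lemma smooth_on_imp_continuous_on: "smooth_on S f \<Longrightarrow> continuous_on S f"
  by (meson continuous_at_imp_continuous_on differentiable_imp_continuous_within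
        smooth_on_imp_differentiable)

lemma smooth_on_directional_derivative:
  assumes "smooth_on S f"
  shows "smooth_on S (directional_derivative f v)"
  using assms unfolding smooth_on_def directional_derivative_def
  by (metis dir_derivs.simps(2))

lemma flat_at_origin_directional_derivative:
  assumes "flat_at_origin f"
  shows "flat_at_origin (directional_derivative f v)"
  using assms unfolding flat_at_origin_def directional_derivative_def
  by (metis dir_derivs.simps(2))

lemma has_derivative_directional_derivative:
  assumes "f differentiable (at x)"
  shows "(f has_derivative (\<lambda>v. directional_derivative f v x)) (at x)"
  using assms frechet_derivative_works by (auto simp: directional_derivative_def)

lemma directional_derivative_eqI:
  "(f has_derivative f') (at x) \<Longrightarrow> directional_derivative f v x = f' v"
  unfolding directional_derivative_def by (metis frechet_derivative_at)

lemma smooth_of_order_cong: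
  assumes "open S" "\<And>x. x \<in> S \<Longrightarrow> f x = g x" "smooth_of_order n S f"
  shows "smooth_of_order n S g"
  using assms(2,3)
proof (induction n arbitrary: f g)
  case 0
  then show ?case
    unfolding smooth_of_order.simps differentiable_def
    by (metis has_derivative_transform_within_open[OF _ assms(1)])
next
  case (Suc n)
  have d: "(g has_derivative (\<lambda>v. directional_derivative f v x)) (at x)" if "x \<in> S" for x
    using Suc.prems that smooth_of_order_imp_differentiable
    by (intro has_derivative_transform_within_open[OF has_derivative_directional_derivative assms(1)])
       auto
  have "smooth_of_order n S (directional_derivative g v)" for v
  proof (rule Suc.IH)
    show "smooth_of_order n S (directional_derivative f v)"
      using Suc.prems by simp
  qed (simp add: directional_derivative_eqI[OF d])
  with d show ?case
    by (auto simp: differentiable_def)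
qed

lemma smooth_of_order_const: "smooth_of_order n S (\<lambda>x. c)"
proof (induction n arbitrary: c)
  case (Suc n)
  have "directional_derivative (\<lambda>x. c) v = (\<lambda>x. 0)" for v :: 'a
    by (auto simp: directional_derivative_def)
  then show ?case using Suc by simp
qed simp

lemma smooth_of_order_bounded_linear:
  assumes "bounded_linear f"
  shows "smooth_of_order n S f"
proof (cases n)
  case 0
  then show ?thesis
    using assms by (auto simp: bounded_linear_imp_differentiable)
next
  case (Suc m)
  have "directional_derivative f v = (\<lambda>x. f v)" for v
    using assms directional_derivative_eqI bounded_linear_imp_has_derivative by fast
  then show ?thesis
    using assms by (auto simp: Suc bounded_linear_imp_differentiable smooth_of_order_const)
qed

lemma smooth_of_order_add:
  fixes f g :: "'a::real_normed_vector \<Rightarrow> 'b::real_normed_vector"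
  assumes "open S"
  shows "smooth_of_order n S f \<Longrightarrow> smooth_of_order n S g \<Longrightarrow> smooth_of_order n S (\<lambda>x. f x + g x)"
proof (induction n arbitrary: f g)
  case (Suc n)
  have d: "((\<lambda>x. f x + g x) has_derivative
        (\<lambda>v. directional_derivative f v x + directional_derivative g v x)) (at x)" if "x \<in> S" for x
    using Suc.prems that smooth_of_order_imp_differentiable
    by (intro has_derivative_add has_derivative_directional_derivative) blast+
  have "smooth_of_order n S (directional_derivative (\<lambda>x. f x + g x) v)" for v
  proof (rule smooth_of_order_cong[OF assms])
    show "smooth_of_order n S (\<lambda>x. directional_derivative f v x + directional_derivative g v x)"
      using Suc.prems by (intro Suc.IH) auto
  qed (simp add: directional_derivative_eqI[OF d])
  with d show ?case by (auto simp: differentiable_def)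
qed (auto intro: differentiable_add)

lemma smooth_of_order_mult:
  fixes f g :: "'a::real_normed_vector \<Rightarrow> real"
  assumes "open S"
  shows "smooth_of_order n S f \<Longrightarrow> smooth_of_order n S g \<Longrightarrow> smooth_of_order n S (\<lambda>x. f x * g x)"
proof (induction n arbitrary: f g)
  case (Suc n)
  have d: "((\<lambda>x. f x * g x) has_derivative
        (\<lambda>v. f x * directional_derivative g v x + directional_derivative f v x * g x)) (at x)"
    if "x \<in> S" for x
    using Suc.prems that smooth_of_order_imp_differentiable
    by (intro has_derivative_mult has_derivative_directional_derivative) blast+
  have "smooth_of_order n S (directional_derivative (\<lambda>x. f x * g x) v)" for v
  proof (rule smooth_of_order_cong[OF assms])
    show "smooth_of_order n S
        (\<lambda>x. f x * directional_derivative g v x + directional_derivative f v x * g x)"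
      using Suc.prems Suc.prems[THEN smooth_of_order_Suc_imp]
      by (intro smooth_of_order_add[OF assms] Suc.IH) simp_all
  qed (simp add: directional_derivative_eqI[OF d])
  with d show ?case by (auto simp: differentiable_def)
qed (auto intro: differentiable_mult)

lemma smooth_of_order_inverse:
  fixes f :: "'a::real_normed_vector \<Rightarrow> real"
  assumes "open S" "\<And>x. x \<in> S \<Longrightarrow> f x \<noteq> 0"
  shows "smooth_of_order n S f \<Longrightarrow> smooth_of_order n S (\<lambda>x. inverse (f x))"
proof (induction n)
  case 0
  then show ?case using assms(2) by (auto intro!: differentiable_inverse)
next
  case (Suc n)
  have d: "((\<lambda>x. inverse (f x)) has_derivative
        (\<lambda>v. - (inverse (f x) * directional_derivative f v x * inverse (f x)))) (at x)"
    if "x \<in> S" for x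
    using Suc.prems that smooth_of_order_imp_differentiable assms(2)
    by (intro Deriv.has_derivative_inverse has_derivative_directional_derivative) blast+
  have "smooth_of_order n S (directional_derivative (\<lambda>x. inverse (f x)) v)" for v
  proof (rule smooth_of_order_cong[OF assms(1)])
    have "smooth_of_order n S (\<lambda>x. inverse (f x))"
      using Suc smooth_of_order_Suc_imp by blast
    then show "smooth_of_order n S
        (\<lambda>x. -1 * ((inverse (f x) * directional_derivative f v x) * inverse (f x)))"
      using Suc.prems
      by (intro smooth_of_order_mult[OF assms(1)] smooth_of_order_const) auto
  qed (simp add: directional_derivative_eqI[OF d])
  with d show ?case by (auto simp: differentiable_def)
qed

lemma smooth_on_const: "smooth_on S (\<lambda>x. c)"
  by (simp add: smooth_on_iff_all_orders smooth_of_order_const)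

lemma smooth_on_bounded_linear: "bounded_linear f \<Longrightarrow> smooth_on S f"
  by (simp add: smooth_on_iff_all_orders smooth_of_order_bounded_linear)

lemma smooth_on_add:
  "open S \<Longrightarrow> smooth_on S f \<Longrightarrow> smooth_on S g \<Longrightarrow> smooth_on S (\<lambda>x. f x + g x)"
  by (simp add: smooth_on_iff_all_orders smooth_of_order_add)

lemma smooth_on_mult:
  fixes f g :: "'a::real_normed_vector \<Rightarrow> real"
  shows "open S \<Longrightarrow> smooth_on S f \<Longrightarrow> smooth_on S g \<Longrightarrow> smooth_on S (\<lambda>x. f x * g x)"
  by (simp add: smooth_on_iff_all_orders smooth_of_order_mult)

lemma smooth_on_divide:
  fixes f g :: "'a::real_normed_vector \<Rightarrow> real"
  assumes "open S" "smooth_on S f" "smooth_on S g" "\<And>x. x \<in> S \<Longrightarrow> g x \<noteq> 0"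
  shows "smooth_on S (\<lambda>x. f x / g x)"
  using assms unfolding divide_inverse
  by (simp add: smooth_on_iff_all_orders smooth_of_order_mult smooth_of_order_inverse)

lemma smooth_on_power:
  fixes f :: "'a::real_normed_vector \<Rightarrow> real"
  assumes "open S" "smooth_on S f"
  shows "smooth_on S (\<lambda>x. f x ^ n)"
  using assms by (induction n) (auto intro: smooth_on_const smooth_on_mult)

abbreviation partial_x :: "(real \<times> real \<Rightarrow> real) \<Rightarrow> real \<times> real \<Rightarrow> real" where
  "partial_x f \<equiv> directional_derivative f (1, 0)"

abbreviation partial_y :: "(real \<times> real \<Rightarrow> real) \<Rightarrow> real \<times> real \<Rightarrow> real" where
  "partial_y f \<equiv> directional_derivative f (0, 1)"

lemma has_real_derivative_partial_x:
  assumes "f differentiable (at (x, y))"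
  shows "((\<lambda>t. f (t, y)) has_real_derivative partial_x f (x, y)) (at x)"
proof -
  let ?D = "\<lambda>v. directional_derivative f v (x, y)"
  have D: "(f has_derivative ?D) (at (x, y))"
    by (rule has_derivative_directional_derivative[OF assms])
  have inner: "((\<lambda>t. (t, y)) has_derivative (\<lambda>h. (h, 0))) (at x)"
    by (intro has_derivative_Pair has_derivative_ident has_derivative_const)
  have "((\<lambda>t. f (t, y)) has_derivative (\<lambda>h. ?D (h, 0))) (at x)"
    by (rule has_derivative_compose[OF inner D])
  moreover have "(\<lambda>h. ?D (h, 0)) = (*) (?D (1, 0))"
  proof
    show "?D (h, 0) = ?D (1, 0) * h" for h
      using linear_scale[OF has_derivative_linear[OF D], of h "(1, 0)"] by simp
  qed
  ultimately show ?thesis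
    by (simp only: has_field_derivative_def)
qed

lemma has_real_derivative_partial_y:
  assumes "f differentiable (at (x, y))"
  shows "((\<lambda>t. f (x, t)) has_real_derivative partial_y f (x, y)) (at y)"
proof -
  let ?D = "\<lambda>v. directional_derivative f v (x, y)"
  have D: "(f has_derivative ?D) (at (x, y))"
    by (rule has_derivative_directional_derivative[OF assms])
  have inner: "((\<lambda>t. (x, t)) has_derivative (\<lambda>h. (0, h))) (at y)"
    by (intro has_derivative_Pair has_derivative_ident has_derivative_const)
  have "((\<lambda>t. f (x, t)) has_derivative (\<lambda>h. ?D (0, h))) (at y)"
    by (rule has_derivative_compose[OF inner D])
  moreover have "(\<lambda>h. ?D (0, h)) = (*) (?D (0, 1))"
  proof
    show "?D (0, h) = ?D (0, 1) * h" for h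
      using linear_scale[OF has_derivative_linear[OF D], of h "(0, 1)"] by simp
  qed
  ultimately show ?thesis
    by (simp only: has_field_derivative_def)
qed

lemma has_real_derivative_directional_derivative:
  fixes f :: "real \<Rightarrow> real"
  assumes "f differentiable (at x)"
  shows "(f has_real_derivative directional_derivative f 1 x) (at x)"
proof -
  have D: "(f has_derivative (\<lambda>v. directional_derivative f v x)) (at x)"
    by (rule has_derivative_directional_derivative[OF assms])
  moreover have "(\<lambda>v. directional_derivative f v x) = (*) (directional_derivative f 1 x)"
  proof
    show "directional_derivative f h x = directional_derivative f 1 x * h" for h
      using linear_scale[OF has_derivative_linear[OF D], of h 1] by simp
  qed
  ultimately show ?thesis
    by (simp only: has_field_derivative_def)
qed

text \<open>Derivatives of flat functions are flat, so a bound \<open>C \<bar>y\<bar>\<^sup>n\<close> for the derivative integrates to the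
bound \<open>C \<bar>y\<bar>\<^bsup>n+1\<^esup>\<close> for the function, by the mean value theorem.\<close>

lemma flat_imp_power_bound:
  fixes g :: "real \<Rightarrow> real"
  assumes "smooth_on S g" "flat_at_origin g" "{-r..r} \<subseteq> S"
  shows "\<exists>C\<ge>0. \<forall>y\<in>{-r..r}. \<bar>g y\<bar> \<le> C * \<bar>y\<bar> ^ n"
  using assms(1,2)
proof (induction n arbitrary: g)
  case 0
  have "compact (g ` {-r..r})"
    using 0 assms(3) smooth_on_imp_continuous_on continuous_on_subset
    by (blast intro: compact_continuous_image)
  then obtain C where "\<forall>y\<in>{-r..r}. \<bar>g y\<bar> \<le> C"
    using compact_imp_bounded bounded_iff by (metis imageI real_norm_def)
  then show ?case by (intro exI[of _ "max 0 C"]) (auto simp: le_max_iff_disj)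
next
  case (Suc n)
  let ?g' = "directional_derivative g 1"
  obtain C where C: "C \<ge> 0" "\<And>y. y \<in> {-r..r} \<Longrightarrow> \<bar>?g' y\<bar> \<le> C * \<bar>y\<bar> ^ n"
    using Suc.IH[of ?g'] Suc.prems smooth_on_directional_derivative
      flat_at_origin_directional_derivative by metis
  have g0: "g 0 = 0"
    using Suc.prems(2) unfolding flat_at_origin_def by (metis dir_derivs.simps(1))
  have "\<bar>g y\<bar> \<le> C * \<bar>y\<bar> ^ Suc n" if y: "y \<in> {-r..r}" for y
  proof -
    have seg: "closed_segment 0 y \<subseteq> {-r..r}" "\<And>t. t \<in> closed_segment 0 y \<Longrightarrow> \<bar>t\<bar> \<le> \<bar>y\<bar>"
      using y by (auto simp: closed_segment_eq_real_ivl split: if_splits)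
    have "norm (g y - g 0) \<le> (C * \<bar>y\<bar> ^ n) * norm (y - 0)"
    proof (rule field_differentiable_bound)
      show "convex (closed_segment 0 y)" by simp
      show "(g has_field_derivative ?g' t) (at t within closed_segment 0 y)"
        if "t \<in> closed_segment 0 y" for t
      proof -
        have "t \<in> S" using that seg(1) assms(3) by blast
        then show ?thesis
          by (rule has_field_derivative_at_within[OF has_real_derivative_directional_derivative[OF
                smooth_on_imp_differentiable[OF Suc.prems(1)]]])
      qed
      show "norm (?g' t) \<le> C * \<bar>y\<bar> ^ n" if "t \<in> closed_segment 0 y" for t
      proof -
        have "\<bar>?g' t\<bar> \<le> C * \<bar>t\<bar> ^ n"
          using C(2) seg(1) that by blast
        also have "\<dots> \<le> C * \<bar>y\<bar> ^ n"
          using seg(2)[OF that] C(1) by (intro mult_left_mono power_mono) auto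
        finally show ?thesis by simp
      qed
    qed auto
    then show ?thesis by (simp add: g0 mult_ac)
  qed
  then show ?case using C(1) by blast
qed

section \<open>Sublevel sets of functions with a large derivative\<close>

text \<open>A greedy choice: take a point of \<open>E\<close> close to its infimum, discard everything up to distance \<open>d\<close>
beyond that point, and repeat.  Each round discards at most the length \<open>2 d\<close>.\<close>

lemma separated_points_or_small_cover:
  fixes E :: "real set" and d :: real
  assumes "d > 0" "bdd_below E"
  shows "(\<exists>x. (\<forall>i<n. x i \<in> E) \<and> (\<forall>i. Suc i < n \<longrightarrow> x i + d \<le> x (Suc i))) \<or>
         (\<exists>A\<in>sets lborel. E \<subseteq> A \<and> emeasure lborel A \<le> ennreal (real n * (2 * d)))"
  using assms(2)
proof (induction n arbitrary: E)
  case (Suc n)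
  show ?case
  proof (cases "E = {}")
    case False
    obtain x0 where x0: "x0 \<in> E" "x0 < Inf E + d"
      using cInf_lessD[OF False, of "Inf E + d"] assms(1) by auto
    have E_split: "E \<subseteq> {Inf E..x0 + d} \<union> (E \<inter> {x0 + d..})"
      using cInf_lower Suc.prems by fastforce
    have "bdd_below (E \<inter> {x0 + d..})" by auto
    from Suc.IH[OF this] show ?thesis
    proof (elim disjE exE bexE)
      fix x assume x: "(\<forall>i<n. x i \<in> E \<inter> {x0 + d..}) \<and> (\<forall>i. Suc i < n \<longrightarrow> x i + d \<le> x (Suc i))"
      define z where "z = case_nat x0 x"
      have "z i \<in> E" if "i < Suc n" for i
        using that x x0 by (cases i) (auto simp: z_def)
      moreover have "z i + d \<le> z (Suc i)" if "Suc i < Suc n" for i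
        using that x by (cases i) (auto simp: z_def)
      ultimately show ?thesis by blast
    next
      fix A assume A: "A \<in> sets lborel"
        "E \<inter> {x0 + d..} \<subseteq> A \<and> emeasure lborel A \<le> ennreal (real n * (2 * d))"
      let ?B = "{Inf E..x0 + d} \<union> A"
      have "Inf E \<le> x0" using x0 Suc.prems by (simp add: cInf_lower)
      have "emeasure lborel ?B \<le> emeasure lborel {Inf E..x0 + d} + emeasure lborel A"
        using A by (intro emeasure_subadditive) auto
      also have "\<dots> \<le> ennreal (2 * d) + ennreal (real n * (2 * d))"
        using A x0 \<open>Inf E \<le> x0\<close> assms(1) by (intro add_mono) (auto intro: ennreal_leI)
      also have "\<dots> = ennreal (real (Suc n) * (2 * d))"
        using assms(1) by (subst ennreal_plus[symmetric]) (auto simp: algebra_simps)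
      finally have "emeasure lborel ?B \<le> ennreal (real (Suc n) * (2 * d))" .
      moreover have "E \<subseteq> ?B" using E_split A(2) by auto
      ultimately show ?thesis using A(1) by (intro disjI2 bexI[of _ ?B]) auto
    qed
  qed (auto intro!: bexI[of _ "{}"])
qed simp

text \<open>The mean value theorem on the pairs \<open>x\<^bsub>2i\<^esub>, x\<^bsub>2i+1\<^esub>\<close> produces points at which the first derivative is
at most \<open>2 \<epsilon> / d\<close>.  Using each sample point only once keeps the new points separated by \<open>d\<close>, at the
price of halving their number; this is why \<open>2\<^sup>a\<close> points are needed for \<open>a\<close> derivatives.\<close>

lemma derivative_bound_at_separated_points:
  fixes D :: "nat \<Rightarrow> real \<Rightarrow> real"
  assumes "is_interval J" "d > 0"
    and "\<And>k x. k < a \<Longrightarrow> x \<in> J \<Longrightarrow> (D k has_real_derivative D (Suc k) x) (at x)"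
    and "\<And>x. x \<in> J \<Longrightarrow> \<bar>D a x\<bar> \<ge> c"
    and "\<And>i. i < 2 ^ a \<Longrightarrow> x i \<in> J \<and> \<bar>D 0 (x i)\<bar> \<le> \<epsilon>"
    and "\<And>i. Suc i < 2 ^ a \<Longrightarrow> x i + d \<le> x (Suc i)"
  shows "c * (d / 2) ^ a \<le> \<epsilon>"
  using assms(3-)
proof (induction a arbitrary: D x \<epsilon>)
  case 0
  show ?case using 0(2)[of "x 0"] 0(3)[of 0] by simp
next
  case (Suc a)
  have "\<exists>z. x (2 * i) < z \<and> z < x (2 * i + 1) \<and> z \<in> J \<and> \<bar>D 1 z\<bar> \<le> 2 * \<epsilon> / d" if i: "i < 2 ^ a" for i
  proof -
    let ?l = "x (2 * i)" and ?u = "x (2 * i + 1)"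
    have i': "2 * i < 2 ^ Suc a" "2 * i + 1 < 2 ^ Suc a" "Suc (2 * i) < 2 ^ Suc a"
      using i unfolding power_Suc by linarith+
    have lu: "?l + d \<le> ?u" "?l \<in> J" "?u \<in> J" "\<bar>D 0 ?l\<bar> \<le> \<epsilon>" "\<bar>D 0 ?u\<bar> \<le> \<epsilon>"
      using Suc.prems(3)[OF i'(1)] Suc.prems(3)[OF i'(2)] Suc.prems(4)[OF i'(3)] by simp_all
    have J: "t \<in> J" if "?l \<le> t" "t \<le> ?u" for t
      using assms(1) lu that unfolding is_interval_1 by blast
    obtain z where z: "?l < z" "z < ?u" "D 0 ?u - D 0 ?l = (?u - ?l) * D 1 z"
      using MVT2[of ?l ?u "D 0" "D 1"] lu assms(2) J Suc.prems(1)[of 0] by auto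
    have "d * \<bar>D 1 z\<bar> \<le> (?u - ?l) * \<bar>D 1 z\<bar>"
      using lu by (intro mult_right_mono) auto
    also have "\<dots> = \<bar>D 0 ?u - D 0 ?l\<bar>"
      using z by (simp add: abs_mult)
    also have "\<dots> \<le> 2 * \<epsilon>" using lu by linarith
    finally have "\<bar>D 1 z\<bar> \<le> 2 * \<epsilon> / d"
      using assms(2) by (simp add: field_simps)
    then show ?thesis using z J by auto
  qed
  then obtain z where z: "\<And>i. i < 2 ^ a \<Longrightarrow>
      x (2 * i) < z i \<and> z i < x (2 * i + 1) \<and> z i \<in> J \<and> \<bar>D 1 (z i)\<bar> \<le> 2 * \<epsilon> / d"
    by metis
  have "c * (d / 2) ^ a \<le> 2 * \<epsilon> / d"
  proof (rule Suc.IH[of "\<lambda>k. D (Suc k)" z])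
    fix i assume i: "Suc i < 2 ^ a"
    then have "x (2 * i + 1) + d \<le> x (Suc (2 * i + 1))"
      by (intro Suc.prems(4)) simp
    with z[of i] z[of "Suc i"] i show "z i + d \<le> z (Suc i)" by simp
  qed (use Suc.prems z in auto)
  then show ?case using assms(2) by (simp add: field_simps)
qed

lemma sublevel_set_cover:
  fixes D :: "nat \<Rightarrow> real \<Rightarrow> real"
  assumes "is_interval J" "bdd_below J" "d > 0" "\<epsilon> < c * (d / 2) ^ a"
    and "\<And>k x. k < a \<Longrightarrow> x \<in> J \<Longrightarrow> (D k has_real_derivative D (Suc k) x) (at x)"
    and "\<And>x. x \<in> J \<Longrightarrow> \<bar>D a x\<bar> \<ge> c"
  shows "\<exists>A\<in>sets lborel. {x\<in>J. \<bar>D 0 x\<bar> \<le> \<epsilon>} \<subseteq> A \<and> emeasure lborel A \<le> ennreal (2 ^ a * (2 * d))"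
proof -
  have "bdd_below {x\<in>J. \<bar>D 0 x\<bar> \<le> \<epsilon>}"
    using assms(2) by (rule bdd_below_mono) auto
  from separated_points_or_small_cover[OF assms(3) this, of "2 ^ a"] show ?thesis
  proof (elim disjE exE)
    fix x assume x: "(\<forall>i<2 ^ a. x i \<in> {x \<in> J. \<bar>D 0 x\<bar> \<le> \<epsilon>}) \<and>
         (\<forall>i. Suc i < 2 ^ a \<longrightarrow> x i + d \<le> x (Suc i))"
    have "c * (d / 2) ^ a \<le> \<epsilon>"
      by (rule derivative_bound_at_separated_points[OF assms(1,3,5,6), of x]) (use x in auto)
    then show ?thesis using assms(4) by simp
  qed simp
qed

lemma dyadic_shell:
  fixes t c :: real
  assumes "0 < t" "t < c"
  shows "\<exists>n::nat. c * (1/2) ^ Suc n \<le> t \<and> t \<le> c * (1/2) ^ n"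
proof -
  have "\<exists>n. c * (1/2::real) ^ n \<le> t"
  proof -
    obtain n where "(1/2::real) ^ n < t / c"
      using real_arch_pow_inv[of "t / c" "1/2"] assms by auto
    then have "c * (1/2::real) ^ n < t"
      using assms by (simp add: field_simps)
    then show ?thesis by (intro exI[of _ n]) simp
  qed
  then obtain n where n: "c * (1/2::real) ^ n \<le> t" "\<And>m. m < n \<Longrightarrow> \<not> c * (1/2::real) ^ m \<le> t"
    using exists_least_iff[of "\<lambda>n. c * (1/2::real) ^ n \<le> t"] by blast
  from n(1) assms have "n \<noteq> 0" by (intro notI) simp
  then obtain m where "n = Suc m" by (cases n) auto
  with n show ?thesis by (intro exI[of _ m]) (auto simp: not_le less_imp_le)
qed

text \<open>Summation over the dyadic shells \<open>c 2\<^bsup>-n-1\<^esup> \<le> \<bar>D 0 x\<bar> \<le> c 2\<^bsup>-n\<^esup>\<close>: by the sublevel estimate the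
\<open>n\<close>-th shell has measure at most a constant times \<open>2\<^bsup>-n/a\<^esup>\<close>, and \<open>\<bar>D 0 x\<bar>\<^sup>\<tau>\<close> is there at most
\<open>c\<^sup>\<tau> 2\<^bsup>-(n+1)\<tau>\<^esup>\<close>.  The resulting series is geometric and converges because \<open>\<tau> > -1/a\<close>.  The essential
point is that \<open>C\<close> is independent of the function and of \<open>c\<close>.  Points with \<open>D 0 x = 0\<close> are
harmless, since \<open>0 powr \<tau> = 0\<close>.\<close>

lemma nn_integral_powr_van_der_Corput:
  fixes \<tau> :: real and a :: nat
  assumes "1 \<le> a" "- (1 / real a) < \<tau>" "\<tau> < 0" "0 \<le> l"
  shows "\<exists>C\<ge>0. \<forall>c>0. \<forall>D :: nat \<Rightarrow> real \<Rightarrow> real. \<forall>J. is_interval J \<longrightarrow> J \<subseteq> {-l..l} \<longrightarrow>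
     (\<forall>k<a. \<forall>x\<in>J. (D k has_real_derivative D (Suc k) x) (at x)) \<longrightarrow>
     (\<forall>x\<in>J. \<bar>D a x\<bar> \<ge> c) \<longrightarrow>
     (\<integral>\<^sup>+x. ennreal (indicator J x * \<bar>D 0 x\<bar> powr \<tau>) \<partial>lborel) \<le> ennreal (C * c powr \<tau>)"
proof -
  \<comment> \<open>\<open>u n\<close> bounds the contribution of the \<open>n\<close>-th shell for \<open>c = 1\<close>.\<close>
  define q where "q = (1/2::real) powr (1 / real a)"
  define u where "u n = (2 ^ a * (2 * (4 * q ^ n))) * ((1/2::real) ^ Suc n) powr \<tau>" for n :: nat
  have q: "0 < q" "q ^ a = 1/2" using assms(1)
    by (auto simp: q_def powr_realpow[symmetric] powr_powr)
  have half: "((1/2::real) ^ n) powr \<tau> = ((1/2) powr \<tau>) ^ n" for n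
    by (simp add: powr_realpow[symmetric] powr_powr mult.commute)
  have u_eq: "u n = (2 ^ a * 8 * (1/2) powr \<tau>) * (q * (1/2) powr \<tau>) ^ n" for n
    unfolding u_def half by (simp add: power_mult_distrib)
  have "q * (1/2) powr \<tau> = (1/2) powr (1 / real a + \<tau>)"
    by (simp add: q_def powr_add)
  also have "\<dots> < 1"
    using assms(2) by (simp add: powr_def ln_div mult_less_0_iff)
  finally have "summable (\<lambda>n. (q * (1/2) powr \<tau>) ^ n)"
    using q(1) by (intro summable_geometric) simp
  then have sum_u: "summable u"
    unfolding u_eq by (rule summable_mult)
  have u_nonneg: "u n \<ge> 0" for n
    using q by (simp add: u_def)
  show ?thesis
  proof (intro exI[of _ "2 * l + suminf u"] conjI allI impI)
    show "0 \<le> 2 * l + suminf u"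
      using assms(4) suminf_nonneg[OF sum_u u_nonneg] by simp
  next
    fix c :: real and D :: "nat \<Rightarrow> real \<Rightarrow> real" and J
    assume "0 < c" and J: "is_interval J" "J \<subseteq> {-l..l}"
      and D: "\<forall>k<a. \<forall>x\<in>J. (D k has_real_derivative D (Suc k) x) (at x)" "\<forall>x\<in>J. c \<le> \<bar>D a x\<bar>"
    \<comment> \<open>The separation \<open>4 q\<^sup>n\<close> satisfies \<open>(4 q\<^sup>n / 2)\<^sup>a = 2\<^sup>a 2\<^bsup>-n\<^esup>\<close>, which exceeds \<open>2\<^bsup>-n\<^esup>\<close> as \<open>a \<ge> 1\<close>.\<close>
    have cover: "\<exists>A\<in>sets lborel. {x\<in>J. \<bar>D 0 x\<bar> \<le> c * (1/2) ^ n} \<subseteq> A \<and>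
        emeasure lborel A \<le> ennreal (2 ^ a * (2 * (4 * q ^ n)))" for n
    proof (rule sublevel_set_cover[OF J(1)])
      show "bdd_below J" using J(2) by (meson bdd_below_Icc bdd_below_mono)
      have "(4 * q ^ n / 2) ^ a = 2 ^ a * (q ^ a) ^ n"
        by (simp add: power_mult_distrib power_mult[symmetric] mult.commute power_divide)
      also have "\<dots> > (1/2) ^ n"
        using assms(1) by (simp add: q field_simps)
      finally show "c * (1/2) ^ n < c * (4 * q ^ n / 2) ^ a"
        using \<open>0 < c\<close> by simp
    qed (use D q in auto)
    have "\<forall>n. \<exists>A. A \<in> sets lborel \<and> {x\<in>J. \<bar>D 0 x\<bar> \<le> c * (1/2) ^ n} \<subseteq> A \<and>
        emeasure lborel A \<le> ennreal (2 ^ a * (2 * (4 * q ^ n)))"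
      using cover unfolding Bex_def by (rule allI)
    from choice[OF this] obtain A where A: "\<And>n. A n \<in> sets lborel" "\<And>n. {x\<in>J. \<bar>D 0 x\<bar> \<le> c * (1/2) ^ n} \<subseteq> A n"
      "\<And>n. emeasure lborel (A n) \<le> ennreal (2 ^ a * (2 * (4 * q ^ n)))"
      by blast
    let ?w = "\<lambda>n. ennreal ((c * (1/2) ^ Suc n) powr \<tau>)"
    have pointwise: "ennreal (indicator J x * \<bar>D 0 x\<bar> powr \<tau>) \<le>
        ennreal (c powr \<tau>) * indicator {-l..l} x + (\<Sum>n. ?w n * indicator (A n) x)" (is "?L \<le> ?R1 + ?R2") for x
    proof (cases "x \<in> J \<and> D 0 x \<noteq> 0")
      case True
      show ?thesis
      proof (cases "\<bar>D 0 x\<bar> < c")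
        case False
        then have "\<bar>D 0 x\<bar> powr \<tau> \<le> c powr \<tau>"
          using \<open>0 < c\<close> assms(3) by (intro powr_mono2') auto
        then have "?L \<le> ?R1" using True J by (auto intro: ennreal_leI)
        then show ?thesis by (simp add: add_increasing2)
      next
        case lt: True
        obtain n where n: "c * (1/2) ^ Suc n \<le> \<bar>D 0 x\<bar>" "\<bar>D 0 x\<bar> \<le> c * (1/2) ^ n"
          using dyadic_shell[of "\<bar>D 0 x\<bar>" c] True lt by auto
        have "x \<in> A n" using A(2)[of n] True n by auto
        have "\<bar>D 0 x\<bar> powr \<tau> \<le> (c * (1/2) ^ Suc n) powr \<tau>"
          using \<open>0 < c\<close> assms(3) n by (intro powr_mono2') auto
        then have "?L \<le> ?w n * indicator (A n) x"
          using True \<open>x \<in> A n\<close> by (auto intro: ennreal_leI)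
        also have "\<dots> = (\<Sum>i\<in>{n}. ?w i * indicator (A i) x)"
          by (simp only: sum.insert finite.emptyI empty_iff not_False_eq_True sum.empty add_0_right)
        also have "\<dots> \<le> ?R2"
          by (intro sum_le_suminf) auto
        finally show ?thesis by (simp add: add_increasing)
      qed
    qed auto
    have "(\<integral>\<^sup>+x. ennreal (indicator J x * \<bar>D 0 x\<bar> powr \<tau>) \<partial>lborel) \<le>
        (\<integral>\<^sup>+x. ennreal (c powr \<tau>) * indicator {-l..l} x + (\<Sum>n. ?w n * indicator (A n) x) \<partial>lborel)"
      by (intro nn_integral_mono pointwise)
    also have "\<dots> = ennreal (c powr \<tau>) * emeasure lborel {-l..l} + (\<Sum>n. ?w n * emeasure lborel (A n))"
      using A(1) by (simp add: nn_integral_add nn_integral_suminf nn_integral_cmult_indicator)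
    also have "\<dots> \<le> ennreal (c powr \<tau>) * ennreal (2 * l) + (\<Sum>n. ennreal (c powr \<tau> * u n))"
    proof (intro add_mono suminf_le)
      show "?w n * emeasure lborel (A n) \<le> ennreal (c powr \<tau> * u n)" for n
      proof -
        have "?w n * emeasure lborel (A n) \<le> ?w n * ennreal (2 ^ a * (2 * (4 * q ^ n)))"
          using A(3) by (intro mult_left_mono) auto
        also have "\<dots> = ennreal (c powr \<tau> * u n)"
          using \<open>0 < c\<close> q powr_mult[of c "(1/2) ^ Suc n" \<tau>]
          by (subst ennreal_mult[symmetric]) (auto simp del: power_Suc simp: u_def mult_ac)
        finally show ?thesis .
      qed
    qed (use assms(4) in auto)
    also have "(\<Sum>n. ennreal (c powr \<tau> * u n)) = ennreal (c powr \<tau> * suminf u)"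
      using sum_u u_nonneg by (subst suminf_ennreal2) (auto simp: suminf_mult intro: summable_mult)
    also have "ennreal (c powr \<tau>) * ennreal (2 * l) + ennreal (c powr \<tau> * suminf u) =
        ennreal ((2 * l + suminf u) * c powr \<tau>)"
      using assms(4) suminf_nonneg[OF sum_u u_nonneg]
      by (simp add: ennreal_mult[symmetric] ennreal_plus[symmetric] algebra_simps del: ennreal_plus)
    finally show "(\<integral>\<^sup>+x. ennreal (indicator J x * \<bar>D 0 x\<bar> powr \<tau>) \<partial>lborel) \<le>
        ennreal ((2 * l + suminf u) * c powr \<tau>)" .
  qed
qed

section \<open>Parameter integrals and complex powers\<close>

text \<open>A local majorant of the integrand also majorizes, up to a factor, its difference quotients, by Cauchy's
estimate on smaller discs; dominated convergence then differentiates under the integral.\<close>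

lemma holomorphic_on_parameter_integral:
  fixes g :: "complex \<Rightarrow> 'a \<Rightarrow> complex"
  assumes "open S"
    and meas: "\<And>s. s \<in> S \<Longrightarrow> g s \<in> borel_measurable M"
    and hol: "\<And>p. p \<in> space M \<Longrightarrow> (\<lambda>s. g s p) holomorphic_on S"
    and dom: "\<And>s. s \<in> S \<Longrightarrow> \<exists>e B. e > 0 \<and> ball s e \<subseteq> S \<and> integrable M B \<and>
        (\<forall>z\<in>ball s e. \<forall>p\<in>space M. norm (g z p) \<le> B p)"
  shows "(\<lambda>s. \<integral>p. g s p \<partial>M) holomorphic_on S"
  unfolding holomorphic_on_def
proof (rule ballI)
  fix s assume "s \<in> S"
  then obtain e B where e: "e > 0" "ball s e \<subseteq> S" and B: "integrable M B"
      "\<And>z p. z \<in> ball s e \<Longrightarrow> p \<in> space M \<Longrightarrow> norm (g z p) \<le> B p"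
    using dom by blast
  define T where "T = ball s (e / 2)"
  have T: "open T" "s \<in> T" "convex T" "T \<subseteq> ball s e"
    using e(1) by (auto simp: T_def)
  have int: "integrable M (g z)" if "z \<in> ball s e" for z
    using that e by (intro Bochner_Integration.integrable_bound[OF B(1)] meas AE_I2)
      (auto intro: order_trans[OF B(2)])
  have der: "((\<lambda>z. g z p) has_field_derivative deriv (\<lambda>z. g z p) z) (at z)"
    if "z \<in> S" "p \<in> space M" for z p
    using hol[OF that(2)] assms(1) that(1) by (rule holomorphic_derivI)
  \<comment> \<open>For \<open>z\<close> within \<open>e/2\<close> of \<open>s\<close>, the disc of radius \<open>e/4\<close> around \<open>z\<close> stays in the region of the majorant.\<close>
  have bound: "norm (deriv (\<lambda>z. g z p) z) \<le> B p / (e / 4)"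
    if "z \<in> T" "p \<in> space M" for z p
  proof -
    have sub: "cball z (e / 4) \<subseteq> ball s e"
    proof
      fix w assume "w \<in> cball z (e / 4)"
      then have "dist s w \<le> dist s z + e / 4"
        using dist_triangle[of s w z] by simp
      then show "w \<in> ball s e" using that(1) e(1) by (simp add: T_def)
    qed
    have hb: "(\<lambda>z. g z p) holomorphic_on cball z (e / 4)"
      using hol[OF that(2)] sub e(2) by (meson holomorphic_on_subset subset_trans)
    have "norm ((deriv ^^ 1) (\<lambda>z. g z p) z) \<le> fact 1 * B p / (e / 4) ^ 1"
    proof (rule Cauchy_inequality)
      show "(\<lambda>z. g z p) holomorphic_on ball z (e / 4)"
        using hb by (rule holomorphic_on_subset) auto
      show "continuous_on (cball z (e / 4)) (\<lambda>z. g z p)"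
        using hb by (rule holomorphic_on_imp_continuous_on)
      show "norm (g x p) \<le> B p" if "norm (z - x) = e / 4" for x
        using that \<open>p \<in> space M\<close> sub by (intro B(2)) (auto simp: dist_norm subset_iff)
    qed (use e in auto)
    then show ?thesis by simp
  qed
  define Q where "Q z p = (g z p - g s p) / (z - s)" for z p
  have Q_bound: "norm (Q z p) \<le> B p / (e / 4)" if "z \<in> T" "z \<noteq> s" "p \<in> space M" for z p
  proof -
    have "norm (g z p - g s p) \<le> (B p / (e / 4)) * norm (z - s)"
    proof (rule field_differentiable_bound[OF T(3)])
      show "((\<lambda>z. g z p) has_field_derivative deriv (\<lambda>z. g z p) w) (at w within T)" if "w \<in> T" for w
        using that T(4) e(2) \<open>p \<in> space M\<close>
        by (intro has_field_derivative_at_within[OF der]) auto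
    qed (use that T bound in auto)
    then show ?thesis
      using that(2) by (simp add: Q_def norm_divide field_simps)
  qed
  let ?D = "\<integral>p. deriv (\<lambda>z. g z p) s \<partial>M"
  have Q_tendsto: "(\<lambda>n. Q (X n) p) \<longlonglongrightarrow> deriv (\<lambda>z. g z p) s"
    if "p \<in> space M" "\<forall>n. X n \<in> T - {s}" "X \<longlonglongrightarrow> s" for X p
  proof -
    have "((\<lambda>z. Q z p) \<longlongrightarrow> deriv (\<lambda>z. g z p) s) (at s)"
      using der[OF \<open>s \<in> S\<close> that(1)] by (simp add: has_field_derivative_iff Q_def)
    then show ?thesis
      using that unfolding tendsto_at_iff_sequentially comp_def by blast
  qed
  have Q_int: "(\<integral>p. Q z p \<partial>M) = ((\<integral>p. g z p \<partial>M) - (\<integral>p. g s p \<partial>M)) / (z - s)" if "z \<in> T" for z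
  proof -
    have "integrable M (g z)" "integrable M (g s)"
      using that T(2,4) by (auto intro: int)
    then show ?thesis
      unfolding Q_def by (simp add: Bochner_Integration.integral_diff)
  qed
  have seq: "(\<lambda>n. ((\<integral>p. g (X n) p \<partial>M) - (\<integral>p. g s p \<partial>M)) / (X n - s)) \<longlonglongrightarrow> ?D"
    if X: "\<forall>n. X n \<in> T - {s}" "X \<longlonglongrightarrow> s" for X
  proof -
    have XT: "X n \<in> T" "X n \<noteq> s" "X n \<in> S" for n
      using X T e by auto
    have meas_Q: "Q (X n) \<in> borel_measurable M" for n
      unfolding Q_def using meas[OF XT(3)] meas[OF \<open>s \<in> S\<close>]
      by (intro borel_measurable_divide borel_measurable_diff borel_measurable_const)
    have "(\<lambda>n. \<integral>p. Q (X n) p \<partial>M) \<longlonglongrightarrow> ?D"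
    proof (rule integral_dominated_convergence)
      show "(\<lambda>p. deriv (\<lambda>z. g z p) s) \<in> borel_measurable M"
      proof (rule borel_measurable_LIMSEQ_metric[where f = "\<lambda>n. Q (X n)"])
        show "Q (X n) \<in> borel_measurable M" for n by (rule meas_Q)
        show "(\<lambda>n. Q (X n) p) \<longlonglongrightarrow> deriv (\<lambda>z. g z p) s" if "p \<in> space M" for p
          by (rule Q_tendsto[OF that X])
      qed
      show "integrable M (\<lambda>p. B p / (e / 4))"
        using B(1) by simp
      show "AE p in M. (\<lambda>n. Q (X n) p) \<longlonglongrightarrow> deriv (\<lambda>z. g z p) s"
        by (intro AE_I2 Q_tendsto X)
      show "AE p in M. norm (Q (X n) p) \<le> B p / (e / 4)" for n
        by (intro AE_I2 Q_bound XT)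
    qed (rule meas_Q)
    then show ?thesis by (simp add: Q_int[OF XT(1)])
  qed
  have "((\<lambda>s. \<integral>p. g s p \<partial>M) has_field_derivative ?D) (at s within T)"
    unfolding has_field_derivative_iff tendsto_at_iff_sequentially comp_def
    using seq by blast
  then have "((\<lambda>s. \<integral>p. g s p \<partial>M) has_field_derivative ?D) (at s)"
    using at_within_open[OF T(2,1)] by simp
  then show "(\<lambda>s. \<integral>p. g s p \<partial>M) field_differentiable at s within S"
    using field_differentiable_at_within field_differentiable_def by blast
qed

lemma of_real_powr_complex:
  fixes t :: real
  assumes "0 \<le> t"
  shows "complex_of_real t powr s = (if t = 0 then 0 else exp (s * complex_of_real (ln t)))"
  using assms by (simp add: powr_def Ln_of_real)

lemma norm_of_real_powr_complex:
  fixes t :: real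
  assumes "0 \<le> t"
  shows "norm (complex_of_real t powr s) = t powr Re s"
  using assms by (simp add: of_real_powr_complex powr_def)

lemma holomorphic_on_of_real_powr:
  fixes t :: real
  assumes "0 \<le> t"
  shows "(\<lambda>s. complex_of_real t powr s) holomorphic_on S"
  using assms by (cases "t = 0") (auto simp: of_real_powr_complex intro!: holomorphic_intros)

lemma borel_measurable_of_real_powr:
  fixes f :: "'a \<Rightarrow> real"
  assumes [measurable]: "f \<in> borel_measurable M" and "\<And>p. 0 \<le> f p"
  shows "(\<lambda>p. complex_of_real (f p) powr s) \<in> borel_measurable M"
proof -
  have "(\<lambda>p. if f p = 0 then 0 else exp (s * complex_of_real (ln (f p)))) \<in> borel_measurable M"
    by measurable
  then show ?thesis using assms(2) by (simp add: of_real_powr_complex)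
qed

lemma has_vector_derivative_of_real_powr:
  fixes t :: real and s :: complex
  assumes "0 < t"
  shows "((\<lambda>t. complex_of_real t powr s) has_vector_derivative s * complex_of_real t powr (s - 1))
    (at t within S)"
proof -
  have "((\<lambda>z. z powr s) has_field_derivative s * complex_of_real t powr (s - 1))
      (at (complex_of_real t))"
    using assms by (auto intro!: derivative_eq_intros simp: complex_nonpos_Reals_iff)
  from has_vector_derivative_real_field[OF this] show ?thesis by simp
qed

lemma norm_powr_diff_le_segment:
  fixes A B :: real and s :: complex
  assumes "0 < B" "B \<le> A"
  shows "norm (complex_of_real A powr s - complex_of_real B powr s) \<le>
    norm s * (A powr (Re s - 1) + B powr (Re s - 1)) * (A - B)"
proof -
  have "norm (complex_of_real A powr s - complex_of_real B powr s) \<le>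
    norm s * (A powr (Re s - 1) + B powr (Re s - 1)) * norm (A - B)"
  proof (rule differentiable_bound[where S = "{B..A}"])
    fix t assume t: "t \<in> {B..A}"
    show "((\<lambda>t. complex_of_real t powr s) has_derivative
        (\<lambda>h. h *\<^sub>R (s * complex_of_real t powr (s - 1)))) (at t within {B..A})"
      using has_vector_derivative_of_real_powr[of t s] t assms
      unfolding has_vector_derivative_def by auto
    have "t powr (Re s - 1) \<le> A powr (Re s - 1) + B powr (Re s - 1)"
    proof (cases "Re s \<ge> 1")
      case True
      then have "t powr (Re s - 1) \<le> A powr (Re s - 1)"
        using t assms by (intro powr_mono2) auto
      then show ?thesis by (simp add: add_increasing2)
    next
      case False
      then have "t powr (Re s - 1) \<le> B powr (Re s - 1)"
        using t assms by (intro powr_mono2') auto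
      then show ?thesis by (simp add: add_increasing)
    qed
    then have "norm (s * complex_of_real t powr (s - 1)) \<le>
        norm s * (A powr (Re s - 1) + B powr (Re s - 1))"
      using t assms by (simp add: norm_mult norm_of_real_powr_complex mult_left_mono)
    then show "onorm (\<lambda>h. h *\<^sub>R (s * complex_of_real t powr (s - 1))) \<le>
        norm s * (A powr (Re s - 1) + B powr (Re s - 1))"
      by (simp add: onorm_scaleR_left[OF bounded_linear_ident] onorm_id)
  qed (use assms in auto)
  then show ?thesis using assms by simp
qed

text \<open>If \<open>A\<close> and \<open>B\<close> differ by more than a factor \<open>2\<close>, then both are at most \<open>2 \<bar>A - B\<bar>\<close>, and the two terms
are estimated separately.  Otherwise \<open>\<bar>A - B\<bar> \<le> min A B\<close>, and the mean value bound
\<open>\<bar>s\<bar> (A\<^bsup>Re s - 1\<^esup> + B\<^bsup>Re s - 1\<^esup>) \<bar>A - B\<bar>\<close> is weakened by splitting \<open>\<bar>A - B\<bar>\<close> into its powers with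
exponents \<open>\<theta>\<close> and \<open>1 - \<theta>\<close>.  The gain over the trivial bound is the factor \<open>\<bar>A - B\<bar>\<^sup>\<theta>\<close>, and the loss
is only \<open>\<theta>\<close> in the exponents.\<close>

lemma norm_powr_diff_le:
  fixes A B \<theta> :: real and s :: complex
  assumes "0 \<le> A" "0 \<le> B" "0 \<le> \<theta>" "\<theta> \<le> 1"
  shows "norm (complex_of_real A powr s - complex_of_real B powr s) \<le>
    (2 + norm s) * \<bar>A - B\<bar> powr \<theta> * (A powr (Re s - \<theta>) + B powr (Re s - \<theta>))"
  using assms(1,2)
proof (induction A B rule: linorder_wlog)
  case (sym A B)
  then show ?case by (simp add: norm_minus_commute abs_minus_commute add.commute)
next
  case (le B A)
  let ?d = "A - B"
  let ?l = "norm (complex_of_real B powr s - complex_of_real A powr s)"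
  let ?w = "A powr (Re s - \<theta>) + B powr (Re s - \<theta>)"
  have absd: "\<bar>B - A\<bar> = ?d" using le by simp
  have split: "t powr Re s = t powr \<theta> * t powr (Re s - \<theta>)" for t :: real
    by (simp add: powr_add[symmetric])
  have "?l \<le> (2 + norm s) * ?d powr \<theta> * ?w"
  proof (cases "A \<le> 2 * B")
    case False
    have "?l \<le> B powr Re s + A powr Re s"
      using le norm_triangle_ineq4[of "complex_of_real B powr s" "complex_of_real A powr s"]
      by (simp add: norm_of_real_powr_complex)
    also have "\<dots> = B powr \<theta> * B powr (Re s - \<theta>) + A powr \<theta> * A powr (Re s - \<theta>)"
      by (metis split)
    also have "\<dots> \<le> (2 * ?d powr \<theta>) * B powr (Re s - \<theta>) + (2 * ?d powr \<theta>) * A powr (Re s - \<theta>)"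
    proof (intro add_mono mult_right_mono)
      have "B powr \<theta> \<le> ?d powr \<theta>"
        using le False assms(3) by (intro powr_mono2) auto
      then show "B powr \<theta> \<le> 2 * ?d powr \<theta>"
        using powr_ge_zero[of ?d \<theta>] by linarith
      have "A powr \<theta> \<le> (2 * ?d) powr \<theta>"
        using le False assms(3) by (intro powr_mono2) auto
      also have "\<dots> = 2 powr \<theta> * ?d powr \<theta>"
        by (rule powr_mult)
      also have "\<dots> \<le> 2 powr 1 * ?d powr \<theta>"
        using assms(4) by (intro mult_right_mono powr_mono) auto
      finally show "A powr \<theta> \<le> 2 * ?d powr \<theta>" by simp
    qed auto
    also have "\<dots> = 2 * ?d powr \<theta> * ?w" by (simp add: algebra_simps)
    also have "\<dots> \<le> (2 + norm s) * ?d powr \<theta> * ?w"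
      by (intro mult_right_mono) auto
    finally show ?thesis .
  next
    case True
    show ?thesis
    proof (cases "A = B")
      case ne: False
      then have B: "0 < B" "0 < ?d" "?d \<le> B" "B \<le> A" using True le by auto
      have d_split: "?d = ?d powr \<theta> * ?d powr (1 - \<theta>)"
        using B by (simp add: powr_add[symmetric])
      have *: "t powr (Re s - 1) * ?d \<le> ?d powr \<theta> * t powr (Re s - \<theta>)" if "?d \<le> t" for t
      proof -
        have "t powr (Re s - 1) * ?d = t powr (Re s - 1) * (?d powr \<theta> * ?d powr (1 - \<theta>))"
          by (rule arg_cong[OF d_split])
        also have "\<dots> = ?d powr \<theta> * (t powr (Re s - 1) * ?d powr (1 - \<theta>))"
          by (simp only: mult_ac)
        also have "\<dots> \<le> ?d powr \<theta> * (t powr (Re s - 1) * t powr (1 - \<theta>))"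
          using that B assms(4) by (intro mult_left_mono powr_mono2) auto
        also have "t powr (Re s - 1) * t powr (1 - \<theta>) = t powr (Re s - \<theta>)"
          by (simp add: powr_add[symmetric])
        finally show ?thesis .
      qed
      have "?l \<le> norm s * (A powr (Re s - 1) + B powr (Re s - 1)) * ?d"
        using norm_powr_diff_le_segment[OF B(1,4), of s] by (simp add: norm_minus_commute)
      also have "\<dots> = norm s * (A powr (Re s - 1) * ?d + B powr (Re s - 1) * ?d)"
        by (simp add: algebra_simps)
      also have "\<dots> \<le> norm s * (?d powr \<theta> * A powr (Re s - \<theta>) + ?d powr \<theta> * B powr (Re s - \<theta>))"
        using B by (intro mult_left_mono add_mono *) auto
      also have "\<dots> = norm s * ?d powr \<theta> * ?w" by (simp add: algebra_simps)
      also have "\<dots> \<le> (2 + norm s) * ?d powr \<theta> * ?w"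
        by (intro mult_right_mono) auto
      finally show ?thesis .
    qed simp
  qed
  then show ?case by (simp only: absd add.commute)
qed

section \<open>Integrability of negative powers on a small square\<close>

definition square :: "real \<Rightarrow> (real \<times> real) set" where
  "square r = {-r<..<r} \<times> {-r<..<r}"

lemma mem_square_iff: "(x, y) \<in> square r \<longleftrightarrow> \<bar>x\<bar> < r \<and> \<bar>y\<bar> < r"
  by (auto simp: square_def)

lemma open_square: "open (square r)"
  unfolding square_def by (intro open_Times open_greaterThanLessThan)

lemma square_mono: "r \<le> r' \<Longrightarrow> square r \<subseteq> square r'"
  by (auto simp: mem_square_iff)

lemma ex_square_subset:
  assumes "open W" "(0, 0) \<in> W"
  shows "\<exists>r>0. square r \<subseteq> W"
proof -
  obtain e where e: "e > 0" "ball (0, 0) e \<subseteq> W"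
    using assms openE by blast
  have "square (e / 2) \<subseteq> ball (0, 0) e"
  proof clarify
    fix x y :: real assume "(x, y) \<in> square (e / 2)"
    then have "norm (x, y) < e"
      using norm_Pair_le[of x y] by (simp add: mem_square_iff)
    then show "(x, y) \<in> ball (0, 0) e"
      by (metis mem_ball_0 zero_prod_def)
  qed
  then show ?thesis using e by (intro exI[of _ "e / 2"]) auto
qed

text \<open>The van der Corput estimate is applied to each horizontal slice separately, so the chain of derivatives may
depend on \<open>y\<close> while the constant \<open>c\<close> may not.  The bound degenerates on the slice \<open>y = 0\<close>, a null set.\<close>

definition x_derivative_bound ::
  "real \<Rightarrow> nat \<Rightarrow> nat \<Rightarrow> real \<Rightarrow> (real \<times> real \<Rightarrow> real) \<Rightarrow> bool" where
  "x_derivative_bound r a b c g \<longleftrightarrow>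
     (\<forall>y\<in>{-r<..<r} - {0}. \<exists>D :: nat \<Rightarrow> real \<Rightarrow> real.
        (\<forall>x\<in>{-r<..<r}. D 0 x = g (x, y)) \<and>
        (\<forall>k<a. \<forall>x\<in>{-r<..<r}. (D k has_real_derivative D (Suc k) x) (at x)) \<and>
        (\<forall>x\<in>{-r<..<r}. c * \<bar>y\<bar> ^ b \<le> \<bar>D a x\<bar>))"

text \<open>From \<open>\<partial>\<^sub>x (x\<^bsup>n+1\<^esup> u) = x\<^sup>n ((n+1) u + x u\<^sub>x)\<close>, differentiation strips one power of \<open>x\<close> and keeps the shape
of the function; on the axis \<open>x = 0\<close> it multiplies \<open>u\<close> by \<open>n + 1\<close>.\<close>

lemma x_derivative_chain_of_monomial_multiple:
  fixes u :: "real \<times> real \<Rightarrow> real"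
  assumes "open S" "smooth_on S u"
  shows "\<exists>D. (\<forall>p. D 0 p = fst p ^ n * u p) \<and> smooth_on S (D n) \<and>
     (\<forall>y. D n (0, y) = fact n * u (0, y)) \<and>
     (\<forall>k<n. \<forall>x y. (x, y) \<in> S \<longrightarrow> ((\<lambda>t. D k (t, y)) has_real_derivative D (Suc k) (x, y)) (at x))"
  using assms(2)
proof (induction n arbitrary: u)
  case 0
  then show ?case by (intro exI[of _ "\<lambda>_. u"]) simp
next
  case (Suc n)
  define u' where "u' = (\<lambda>p. real (Suc n) * u p + fst p * partial_x u p)"
  have "smooth_on S u'"
    unfolding u'_def using Suc.prems
    by (intro smooth_on_add[OF assms(1)] smooth_on_mult[OF assms(1)] smooth_on_const
        smooth_on_directional_derivative smooth_on_bounded_linear[OF bounded_linear_fst])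
  from Suc.IH[OF this] obtain D where D: "\<And>p. D 0 p = fst p ^ n * u' p" "smooth_on S (D n)"
     "\<And>y. D n (0, y) = fact n * u' (0, y)"
     "\<And>k x y. k < n \<Longrightarrow> (x, y) \<in> S \<Longrightarrow> ((\<lambda>t. D k (t, y)) has_real_derivative D (Suc k) (x, y)) (at x)"
    by blast
  define E where "E = case_nat (\<lambda>p. fst p ^ Suc n * u p) D"
  have first: "((\<lambda>t. E 0 (t, y)) has_real_derivative E 1 (x, y)) (at x)" if "(x, y) \<in> S" for x y
  proof -
    have "((\<lambda>t. t ^ Suc n * u (t, y)) has_real_derivative
        (real (Suc n) * x ^ n) * u (x, y) + partial_x u (x, y) * x ^ Suc n) (at x)"
      using DERIV_mult[OF DERIV_pow[of "Suc n" x]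
          has_real_derivative_partial_x[OF smooth_on_imp_differentiable[OF Suc.prems that]]]
      by simp
    moreover have "(real (Suc n) * x ^ n) * u (x, y) + partial_x u (x, y) * x ^ Suc n = E 1 (x, y)"
      by (simp add: E_def D(1) u'_def algebra_simps)
    ultimately show ?thesis by (simp add: E_def)
  qed
  show ?case
  proof (intro exI[of _ E] conjI allI impI)
    show "E 0 p = fst p ^ Suc n * u p" for p by (simp add: E_def)
    show "smooth_on S (E (Suc n))" using D(2) by (simp add: E_def)
    show "E (Suc n) (0, y) = fact (Suc n) * u (0, y)" for y
      by (simp add: E_def D(3) u'_def)
    show "((\<lambda>t. E k (t, y)) has_real_derivative E (Suc k) (x, y)) (at x)"
      if "k < Suc n" "(x, y) \<in> S" for k x y
    proof (cases k)
      case 0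
      with first[OF that(2)] show ?thesis by simp
    next
      case (Suc m)
      with D(4)[of m x y] that show ?thesis by (simp add: E_def)
    qed
  qed
qed

lemma derivative_chain_of_polynomial:
  "\<exists>E :: nat \<Rightarrow> real \<Rightarrow> real. (\<forall>x. E 0 x = (\<Sum>j<n. x ^ j * c j)) \<and> (\<forall>x. E n x = 0) \<and>
     (\<forall>k<n. \<forall>x. (E k has_real_derivative E (Suc k) x) (at x))"
proof (induction n arbitrary: c)
  case 0
  then show ?case by (intro exI[of _ "\<lambda>_ _. 0"]) simp
next
  case (Suc n)
  obtain E where E: "\<And>x. E 0 x = (\<Sum>j<n. x ^ j * (real (Suc j) * c (Suc j)))" "\<And>x. E n x = 0"
     "\<And>k x. k < n \<Longrightarrow> (E k has_real_derivative E (Suc k) x) (at x)"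
    using Suc.IH[of "\<lambda>j. real (Suc j) * c (Suc j)"] by blast
  define F where "F = case_nat (\<lambda>x. \<Sum>j<Suc n. x ^ j * c j) E"
  have F0: "F 0 = (\<lambda>x. c 0 + (\<Sum>j<n. x ^ Suc j * c (Suc j)))"
    unfolding F_def by (rule ext) (subst sum.lessThan_Suc_shift, simp)
  have "(F 0 has_real_derivative 0 + (\<Sum>j<n. real (Suc j) * x ^ j * c (Suc j))) (at x)" for x
    unfolding F0 using DERIV_pow[of "Suc _" x]
    by (intro DERIV_add DERIV_sum DERIV_const DERIV_cmult_right) simp
  then have first: "(F 0 has_real_derivative F (Suc 0) x) (at x)" for x
    by (simp add: F_def E(1) mult_ac)
  show ?case
  proof (intro exI[of _ F] conjI allI impI)
    show "(F k has_real_derivative F (Suc k) x) (at x)" if "k < Suc n" for k x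
    proof (cases k)
      case 0
      with first show ?thesis by simp
    next
      case (Suc m)
      with E(3)[of m x] that show ?thesis by (simp add: F_def)
    qed
  qed (simp_all add: F_def E(2))
qed

text \<open>The sum of the \<open>x\<^sup>j h\<^sub>j(y)\<close> with \<open>j < a\<close> disappears after \<open>a\<close> derivatives in \<open>x\<close>, so the constants
do not depend on the \<open>h\<^sub>j\<close>.  With \<open>h = 0\<close> this covers the unperturbed function \<open>v x\<^sup>a y\<^sup>b\<close> as well.\<close>

lemma ex_x_derivative_bound:
  assumes "open S" "(0, 0) \<in> S" "smooth_on S v" "v (0, 0) > 0"
  shows "\<exists>c>0. \<exists>r0>0. \<forall>r\<le>r0. \<forall>g :: real \<times> real \<Rightarrow> real. \<forall>h :: nat \<Rightarrow> real \<Rightarrow> real.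
    (\<forall>x y. (x, y) \<in> square r \<longrightarrow> g (x, y) = v (x, y) * x ^ a * y ^ b + (\<Sum>j<a. x ^ j * h j y)) \<longrightarrow>
    x_derivative_bound r a b c g"
proof -
  obtain D where D: "\<And>p. D 0 p = fst p ^ a * v p" "smooth_on S (D a)"
     "\<And>y. D a (0, y) = fact a * v (0, y)"
     "\<And>k x y. k < a \<Longrightarrow> (x, y) \<in> S \<Longrightarrow> ((\<lambda>t. D k (t, y)) has_real_derivative D (Suc k) (x, y)) (at x)"
    using x_derivative_chain_of_monomial_multiple[OF assms(1,3), of a] by blast
  define c where "c = D a (0, 0) / 2"
  have c: "c > 0" "c < D a (0, 0)" using assms(4) by (simp_all add: c_def D(3))
  define W where "W = S \<inter> D a -` {c<..}"
  have "open W"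
    unfolding W_def using assms(1) smooth_on_imp_continuous_on[OF D(2)]
    by (intro continuous_open_preimage) auto
  moreover have "(0, 0) \<in> W" using assms(2) c by (simp add: W_def)
  ultimately obtain r0 where r0: "r0 > 0" "square r0 \<subseteq> W"
    using ex_square_subset by blast
  have "x_derivative_bound r a b c g" if "r \<le> r0"
    "\<forall>x y. (x, y) \<in> square r \<longrightarrow> g (x, y) = v (x, y) * x ^ a * y ^ b + (\<Sum>j<a. x ^ j * h j y)"
    for r g h
  proof -
    note g = that(2)
    have sub: "square r \<subseteq> W"
      using square_mono[OF that(1)] r0(2) by blast
    show "x_derivative_bound r a b c g"
      unfolding x_derivative_bound_def
    proof
      fix y assume y: "y \<in> {-r<..<r} - {0}"
      obtain E where E: "\<And>x. E 0 x = (\<Sum>j<a. x ^ j * h j y)" "\<And>x. E a x = 0"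
        "\<And>k x. k < a \<Longrightarrow> (E k has_real_derivative E (Suc k) x) (at x)"
        using derivative_chain_of_polynomial[where n = a and c = "\<lambda>j. h j y"] by blast
      define G where "G k x = y ^ b * D k (x, y) + E k x" for k x
      have in_square: "(x, y) \<in> square r" if "x \<in> {-r<..<r}" for x
        using that y by (simp add: square_def)
      have in_W: "(x, y) \<in> W" if "x \<in> {-r<..<r}" for x
        using in_square[OF that] sub by blast
      show "\<exists>D. (\<forall>x\<in>{-r<..<r}. D 0 x = g (x, y)) \<and>
        (\<forall>k<a. \<forall>x\<in>{-r<..<r}. (D k has_real_derivative D (Suc k) x) (at x)) \<and>
        (\<forall>x\<in>{-r<..<r}. c * \<bar>y\<bar> ^ b \<le> \<bar>D a x\<bar>)"
      proof (intro exI[of _ G] conjI ballI allI impI)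
        fix k x assume "k < a" and x: "x \<in> {-r<..<r}"
        then show "(G k has_real_derivative G (Suc k) x) (at x)"
          unfolding G_def using in_W[OF x]
          by (intro DERIV_add DERIV_cmult D(4) E(3)) (auto simp: W_def)
      next
        fix x assume x: "x \<in> {-r<..<r}"
        show "G 0 x = g (x, y)"
          using g in_square[OF x] by (simp add: G_def E(1) D(1) mult_ac)
        have "c < D a (x, y)" using in_W[OF x] by (simp add: W_def)
        then have "c * \<bar>y\<bar> ^ b \<le> D a (x, y) * \<bar>y\<bar> ^ b"
          by (intro mult_right_mono) auto
        also have "\<dots> = \<bar>G a x\<bar>"
          using \<open>c < D a (x, y)\<close> c(1) by (simp add: G_def E(2) abs_mult power_abs)
        finally show "c * \<bar>y\<bar> ^ b \<le> \<bar>G a x\<bar>" .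
      qed
    qed
  qed
  with c(1) r0(1) show ?thesis by blast
qed

text \<open>For negative exponents this is the van der Corput estimate for the identity function and a single
derivative.\<close>

lemma nn_integral_powr_interval_finite:
  fixes \<beta> r :: real
  assumes "-1 < \<beta>" "0 < r"
  shows "(\<integral>\<^sup>+y. ennreal (indicator {-r<..<r} y * \<bar>y\<bar> powr \<beta>) \<partial>lborel) < \<infinity>"
proof (cases "\<beta> < 0")
  case True
  define D :: "nat \<Rightarrow> real \<Rightarrow> real" where "D = (\<lambda>k. if k = 0 then (\<lambda>x. x) else (\<lambda>x. 1))"
  obtain C where C: "\<forall>c>0. \<forall>D :: nat \<Rightarrow> real \<Rightarrow> real. \<forall>J. is_interval J \<longrightarrow> J \<subseteq> {-r..r} \<longrightarrow>
     (\<forall>k<1. \<forall>x\<in>J. (D k has_real_derivative D (Suc k) x) (at x)) \<longrightarrow>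
     (\<forall>x\<in>J. \<bar>D 1 x\<bar> \<ge> c) \<longrightarrow>
     (\<integral>\<^sup>+x. ennreal (indicator J x * \<bar>D 0 x\<bar> powr \<beta>) \<partial>lborel) \<le> ennreal (C * c powr \<beta>)"
    using nn_integral_powr_van_der_Corput[of 1 \<beta> r] assms True by auto
  have "(\<integral>\<^sup>+x. ennreal (indicator {-r<..<r} x * \<bar>D 0 x\<bar> powr \<beta>) \<partial>lborel) \<le> ennreal (C * 1 powr \<beta>)"
    by (rule C[rule_format]) (auto simp: D_def is_interval_oo)
  then show ?thesis by (simp add: D_def le_less_trans)
next
  case False
  have "(\<integral>\<^sup>+y. ennreal (indicator {-r<..<r} y * \<bar>y\<bar> powr \<beta>) \<partial>lborel) \<le>
      (\<integral>\<^sup>+y. ennreal (r powr \<beta>) * indicator {-r<..<r} y \<partial>lborel)"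
    using False by (intro nn_integral_mono)
      (auto simp: indicator_def intro!: ennreal_leI powr_mono2)
  also have "\<dots> < \<infinity>"
    using assms(2) by (simp add: nn_integral_cmult_indicator ennreal_mult_less_top)
  finally show ?thesis .
qed

lemma borel_measurable_indicator_square:
  fixes g :: "real \<times> real \<Rightarrow> real"
  assumes "continuous_on (square r) g"
  shows "(\<lambda>p. indicator (square r) p * g p) \<in> borel_measurable borel"
  using borel_measurable_continuous_on_indicator[OF _ assms] open_square by simp

text \<open>Tonelli's theorem, integrating first over \<open>x\<close>: the slice at height \<open>y\<close> contributes at most a constant times
\<open>\<bar>y\<bar>\<^bsup>\<kappa> + b \<tau>\<^esup>\<close>.  On the line \<open>y = 0\<close> the integrand vanishes, since \<open>0 powr \<kappa> = 0\<close> for every \<open>\<kappa>\<close>.\<close>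

lemma integrable_weighted_powr:
  fixes \<tau> \<kappa> c r :: real
  assumes "1 \<le> a" "- (1 / real a) < \<tau>" "\<tau> < 0" "0 < r" "0 < c" "-1 < \<kappa> + real b * \<tau>"
    and "continuous_on (square r) g" "x_derivative_bound r a b c g"
  shows "integrable lborel (\<lambda>p. indicator (square r) p * (\<bar>snd p\<bar> powr \<kappa> * \<bar>g p\<bar> powr \<tau>))"
    (is "integrable lborel ?F")
proof -
  define g' where "g' p = indicator (square r) p * g p" for p
  have [measurable]: "g' \<in> borel_measurable borel"
    unfolding g'_def by (rule borel_measurable_indicator_square[OF assms(7)])
  have [measurable]: "square r \<in> sets borel" using open_square by simp
  have [measurable]: "snd \<in> borel_measurable (borel :: (real \<times> real) measure)"
    by (intro borel_measurable_continuous_onI continuous_on_snd continuous_on_id)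
  have pair: "(\<lambda>x. (x, y)) \<in> borel \<rightarrow>\<^sub>M (borel :: (real \<times> real) measure)" for y :: real
    by (intro borel_measurable_continuous_onI continuous_on_Pair continuous_on_const continuous_on_id)
  have [measurable]: "(\<lambda>x. g' (x, y)) \<in> borel_measurable borel" for y
    using measurable_compose[OF pair] \<open>g' \<in> borel_measurable borel\<close> by blast
  have F_eq: "?F p = indicator (square r) p * (\<bar>snd p\<bar> powr \<kappa> * \<bar>g' p\<bar> powr \<tau>)" for p
    by (simp add: g'_def indicator_def)
  have meas [measurable]: "?F \<in> borel_measurable borel"
    unfolding F_eq by measurable
  let ?J = "{-r<..<r}"
  obtain C where "C \<ge> 0" and C: "\<forall>c>0. \<forall>D :: nat \<Rightarrow> real \<Rightarrow> real. \<forall>J. is_interval J \<longrightarrow> J \<subseteq> {-r..r} \<longrightarrow>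
     (\<forall>k<a. \<forall>x\<in>J. (D k has_real_derivative D (Suc k) x) (at x)) \<longrightarrow>
     (\<forall>x\<in>J. \<bar>D a x\<bar> \<ge> c) \<longrightarrow>
     (\<integral>\<^sup>+x. ennreal (indicator J x * \<bar>D 0 x\<bar> powr \<tau>) \<partial>lborel) \<le> ennreal (C * c powr \<tau>)"
    using nn_integral_powr_van_der_Corput[OF assms(1-3), of r] assms(4) by auto
  have slice: "(\<integral>\<^sup>+x. ennreal (?F (x, y)) \<partial>lborel) \<le>
      ennreal (C * c powr \<tau>) * ennreal (indicator ?J y * \<bar>y\<bar> powr (\<kappa> + real b * \<tau>))" for y
  proof (cases "y \<in> ?J - {0}")
    case True
    then obtain D :: "nat \<Rightarrow> real \<Rightarrow> real" where D: "\<forall>x\<in>?J. D 0 x = g (x, y)"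
        "\<forall>k<a. \<forall>x\<in>?J. (D k has_real_derivative D (Suc k) x) (at x)"
        "\<forall>x\<in>?J. c * \<bar>y\<bar> ^ b \<le> \<bar>D a x\<bar>"
      using assms(8) unfolding x_derivative_bound_def by blast
    have slice_eq: "ennreal (?F (x, y)) =
        ennreal (\<bar>y\<bar> powr \<kappa>) * ennreal (indicator ?J x * \<bar>D 0 x\<bar> powr \<tau>)" for x
      using True D(1) by (auto simp: indicator_def mem_square_iff ennreal_mult)
    have meas_D: "(\<lambda>x. ennreal (indicator ?J x * \<bar>D 0 x\<bar> powr \<tau>)) \<in> borel_measurable lborel"
    proof -
      have "(\<lambda>x. indicator ?J x * \<bar>g' (x, y)\<bar> powr \<tau>) \<in> borel_measurable lborel"
        by measurable
      also have "(\<lambda>x. indicator ?J x * \<bar>g' (x, y)\<bar> powr \<tau>) = (\<lambda>x. indicator ?J x * \<bar>D 0 x\<bar> powr \<tau>)"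
        using True D(1) by (auto simp: g'_def indicator_def mem_square_iff fun_eq_iff)
      finally show ?thesis by measurable
    qed
    have "(\<integral>\<^sup>+x. ennreal (?F (x, y)) \<partial>lborel) =
        ennreal (\<bar>y\<bar> powr \<kappa>) * (\<integral>\<^sup>+x. ennreal (indicator ?J x * \<bar>D 0 x\<bar> powr \<tau>) \<partial>lborel)"
      unfolding slice_eq using meas_D by (rule nn_integral_cmult)
    also have "\<dots> \<le> ennreal (\<bar>y\<bar> powr \<kappa>) * ennreal (C * (c * \<bar>y\<bar> ^ b) powr \<tau>)"
    proof (rule mult_left_mono)
      show "(\<integral>\<^sup>+x. ennreal (indicator ?J x * \<bar>D 0 x\<bar> powr \<tau>) \<partial>lborel) \<le>
          ennreal (C * (c * \<bar>y\<bar> ^ b) powr \<tau>)"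
        by (rule C[rule_format]) (use D True assms(5) in \<open>auto simp: is_interval_oo\<close>)
    qed simp
    also have "\<dots> = ennreal (\<bar>y\<bar> powr \<kappa> * (C * (c powr \<tau> * \<bar>y\<bar> powr (real b * \<tau>))))"
    proof -
      have "(\<bar>y\<bar> ^ b) powr \<tau> = \<bar>y\<bar> powr (real b * \<tau>)"
        using True by (simp add: powr_realpow[symmetric] powr_powr)
      then show ?thesis
        using \<open>C \<ge> 0\<close> by (simp add: ennreal_mult powr_mult)
    qed
    also have "\<bar>y\<bar> powr \<kappa> * (C * (c powr \<tau> * \<bar>y\<bar> powr (real b * \<tau>))) =
        (C * c powr \<tau>) * (indicator ?J y * \<bar>y\<bar> powr (\<kappa> + real b * \<tau>))"
      using True by (simp add: powr_add mult_ac)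
    also have "ennreal \<dots> = ennreal (C * c powr \<tau>) * ennreal (indicator ?J y * \<bar>y\<bar> powr (\<kappa> + real b * \<tau>))"
      using \<open>C \<ge> 0\<close> by (intro ennreal_mult) auto
    finally show ?thesis .
  next
    case False
    then have "(\<lambda>x. ennreal (?F (x, y))) = (\<lambda>x. 0)"
      by (auto simp: indicator_def square_def)
    then have "(\<integral>\<^sup>+x. ennreal (?F (x, y)) \<partial>lborel) = 0"
      by (simp only: nn_integral_const mult_zero_left)
    then show ?thesis by (simp only: zero_le)
  qed
  have "(\<integral>\<^sup>+p. ennreal (?F p) \<partial>lborel) = (\<integral>\<^sup>+y. \<integral>\<^sup>+x. ennreal (?F (x, y)) \<partial>lborel \<partial>lborel)"
    unfolding lborel_prod[symmetric]
    by (subst lborel_pair.nn_integral_snd) (simp_all add: lborel_prod)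
  also have "\<dots> \<le> (\<integral>\<^sup>+y. ennreal (C * c powr \<tau>) *
      ennreal (indicator ?J y * \<bar>y\<bar> powr (\<kappa> + real b * \<tau>)) \<partial>lborel)"
    by (intro nn_integral_mono slice)
  also have "\<dots> = ennreal (C * c powr \<tau>) *
      (\<integral>\<^sup>+y. ennreal (indicator ?J y * \<bar>y\<bar> powr (\<kappa> + real b * \<tau>)) \<partial>lborel)"
    by (intro nn_integral_cmult) measurable
  also have "\<dots> < \<infinity>"
    using nn_integral_powr_interval_finite[OF assms(6,4)] by (simp add: ennreal_mult_less_top)
  finally show ?thesis
    by (intro integrableI_nonneg) (auto simp: meas)
qed

section \<open>Zeta integrals on a square\<close>

text \<open>Smoothness is required on the square only, so that multiplication by functions that are smooth just there, such as
the logarithmic derivative of \<open>v\<close>, visibly stays within the class.\<close>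

definition compact_smooth :: "real \<Rightarrow> (real \<times> real \<Rightarrow> real) set" where
  "compact_smooth r = {\<phi>. smooth_on (square r) \<phi> \<and>
     (\<exists>K. compact K \<and> K \<subseteq> square r \<and> (\<forall>q. q \<notin> K \<longrightarrow> \<phi> q = 0))}"

lemma test_functions_subset_compact_smooth:
  "test_functions (square r) \<subseteq> compact_smooth r"
proof
  fix \<phi> assume "\<phi> \<in> test_functions (square r)"
  then have \<phi>: "smooth_on UNIV \<phi>" "compact (closure {p. \<phi> p \<noteq> 0})"
      "closure {p. \<phi> p \<noteq> 0} \<subseteq> square r"
    by (simp_all only: test_functions_def mem_Collect_eq)
  have "\<forall>q. q \<notin> closure {p. \<phi> p \<noteq> 0} \<longrightarrow> \<phi> q = 0"
    using closure_subset[of "{p. \<phi> p \<noteq> 0}"] by auto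
  with \<phi>(2,3) have "\<exists>K. compact K \<and> K \<subseteq> square r \<and> (\<forall>q. q \<notin> K \<longrightarrow> \<phi> q = 0)"
    by (intro exI[of _ "closure {p. \<phi> p \<noteq> 0}"] conjI)
  with smooth_on_subset[OF \<phi>(1)] show "\<phi> \<in> compact_smooth r"
    by (simp add: compact_smooth_def)
qed

lemma compact_smooth_mult:
  assumes "\<phi> \<in> compact_smooth r" "smooth_on (square r) g"
  shows "(\<lambda>q. \<phi> q * g q) \<in> compact_smooth r"
proof -
  obtain K where "compact K" "K \<subseteq> square r" "\<forall>q. q \<notin> K \<longrightarrow> \<phi> q = 0" and "smooth_on (square r) \<phi>"
    using assms(1) unfolding compact_smooth_def by blast
  then show ?thesis
    using smooth_on_mult[OF open_square _ assms(2)]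
    unfolding compact_smooth_def by (intro CollectI conjI exI[of _ K]) simp_all
qed

lemma directional_derivative_eq_0_outside:
  assumes "closed K" "\<And>q. q \<notin> K \<Longrightarrow> \<phi> q = 0" "q \<notin> K"
  shows "directional_derivative \<phi> v q = 0"
proof -
  have "(\<phi> has_derivative (\<lambda>v. 0)) (at q)"
    using assms(2,3)
    by (intro has_derivative_transform_within_open[OF has_derivative_const, of "- K" q 0])
       (use assms(1) in auto)
  then show ?thesis by (rule directional_derivative_eqI)
qed

lemma compact_smooth_directional_derivative:
  assumes "\<phi> \<in> compact_smooth r"
  shows "directional_derivative \<phi> v \<in> compact_smooth r"
proof -
  obtain K where K: "compact K" "K \<subseteq> square r" "\<And>q. q \<notin> K \<Longrightarrow> \<phi> q = 0"
    using assms unfolding compact_smooth_def by blast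
  have "directional_derivative \<phi> v q = 0" if "q \<notin> K" for q
    using directional_derivative_eq_0_outside[OF compact_imp_closed[OF K(1)] K(3) that] .
  moreover have "smooth_on (square r) (directional_derivative \<phi> v)"
    using assms smooth_on_directional_derivative unfolding compact_smooth_def by blast
  ultimately show ?thesis
    using K unfolding compact_smooth_def by blast
qed

lemma compact_smooth_bounded:
  assumes "\<phi> \<in> compact_smooth r"
  shows "\<exists>M\<ge>0. \<forall>q. \<bar>\<phi> q\<bar> \<le> M * indicator (square r) q"
proof -
  obtain K where K: "compact K" "K \<subseteq> square r" "\<And>q. q \<notin> K \<Longrightarrow> \<phi> q = 0"
    and \<phi>: "smooth_on (square r) \<phi>"
    using assms unfolding compact_smooth_def by blast
  have "continuous_on K \<phi>"
    using smooth_on_imp_continuous_on[OF \<phi>] K(2) continuous_on_subset by blast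
  then have "bounded (\<phi> ` K)"
    using K(1) compact_continuous_image compact_imp_bounded by blast
  then obtain M where M: "\<And>q. q \<in> K \<Longrightarrow> \<bar>\<phi> q\<bar> \<le> M"
    unfolding bounded_iff by auto
  have "\<bar>\<phi> q\<bar> \<le> max 0 M * indicator (square r) q" for q
  proof (cases "q \<in> K")
    case True
    with M[OF True] K(2) show ?thesis by (auto simp: indicator_def)
  next
    case False
    then show ?thesis by (simp add: K(3))
  qed
  then show ?thesis by (intro exI[of _ "max 0 M"]) auto
qed

lemma compact_smooth_zero_outside:
  "\<phi> \<in> compact_smooth r \<Longrightarrow> q \<notin> square r \<Longrightarrow> \<phi> q = 0"
  unfolding compact_smooth_def by blast

lemma borel_measurable_zeta_integrand:
  assumes "continuous_on (square r) g" "\<phi> \<in> compact_smooth r"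
  shows "zeta_integrand g \<phi> s \<in> borel_measurable borel"
proof -
  define g' where "g' p = indicator (square r) p * g p" for p
  define \<phi>' where "\<phi>' p = indicator (square r) p * \<phi> p" for p
  have g' [measurable]: "g' \<in> borel_measurable borel"
    unfolding g'_def by (rule borel_measurable_indicator_square[OF assms(1)])
  have [measurable]: "\<phi>' \<in> borel_measurable borel"
    unfolding \<phi>'_def using assms(2)
    by (intro borel_measurable_indicator_square smooth_on_imp_continuous_on)
       (auto simp: compact_smooth_def)
  have [measurable]: "(\<lambda>p. complex_of_real \<bar>g' p\<bar> powr s) \<in> borel_measurable borel"
    by (rule borel_measurable_of_real_powr) (use g' in auto)
  have "zeta_integrand g \<phi> s = (\<lambda>p. complex_of_real \<bar>g' p\<bar> powr s * complex_of_real (\<phi>' p))"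
    using compact_smooth_zero_outside[OF assms(2)]
    by (auto simp: zeta_integrand_def g'_def \<phi>'_def indicator_def fun_eq_iff)
  then show ?thesis by simp
qed

lemma integrable_indicator_square: "integrable lborel (\<lambda>p. M * indicator (square r) p :: real)"
proof -
  have "bounded (square r)"
    unfolding square_def by (intro bounded_Times) (auto intro: bounded_subset[OF bounded_closed_interval[of "-r" r]])
  then have "emeasure lborel (square r) < \<infinity>"
    by (rule emeasure_bounded_finite)
  then have "integrable lborel (indicator (square r) :: _ \<Rightarrow> real)"
    using open_square by (intro integrable_real_indicator) auto
  then show ?thesis by (rule integrable_mult_right)
qed

lemma norm_zeta_integrand:
  "norm (zeta_integrand g \<phi> s p) = \<bar>g p\<bar> powr Re s * \<bar>\<phi> p\<bar>"
  by (simp add: zeta_integrand_def norm_mult norm_of_real_powr_complex)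

lemma zeta_integrand_bounded:
  assumes "\<And>p. p \<in> square r \<Longrightarrow> \<bar>g p\<bar> \<le> 1" "0 \<le> Re s"
    and "\<And>q. \<bar>\<phi> q\<bar> \<le> M * indicator (square r) q"
  shows "norm (zeta_integrand g \<phi> s p) \<le> M * indicator (square r) p"
proof (cases "p \<in> square r")
  case True
  then have "\<bar>g p\<bar> powr Re s \<le> 1"
    using assms(1,2) powr_le1 by simp
  then have "\<bar>g p\<bar> powr Re s * \<bar>\<phi> p\<bar> \<le> 1 * \<bar>\<phi> p\<bar>"
    by (rule mult_right_mono) simp
  with assms(3)[of p] show ?thesis by (simp add: norm_zeta_integrand)
next
  case False
  with assms(3)[of p] show ?thesis by (simp add: norm_zeta_integrand)
qed

lemma integrable_zeta_integrand:
  assumes "continuous_on (square r) g" "\<And>p. p \<in> square r \<Longrightarrow> \<bar>g p\<bar> \<le> 1"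
    and "\<phi> \<in> compact_smooth r" "0 \<le> Re s"
  shows "integrable lborel (zeta_integrand g \<phi> s)"
proof -
  obtain M where M: "\<And>q. \<bar>\<phi> q\<bar> \<le> M * indicator (square r) q"
    using compact_smooth_bounded[OF assms(3)] by blast
  have "norm (zeta_integrand g \<phi> s p) \<le> norm (M * indicator (square r) p :: real)" for p
    using order_trans[OF zeta_integrand_bounded[OF assms(2,4) M, where p = p] abs_ge_self] by simp
  then show ?thesis
    using borel_measurable_zeta_integrand[OF assms(1,3)]
    by (intro Bochner_Integration.integrable_bound[OF integrable_indicator_square[of M r]]) auto
qed

lemma holomorphic_on_zeta_integrand: "(\<lambda>s. zeta_integrand g \<phi> s p) holomorphic_on S"
  unfolding zeta_integrand_def
  by (intro holomorphic_on_mult holomorphic_on_of_real_powr holomorphic_on_const) simp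

lemma local_zeta_holomorphic_right_half_plane:
  assumes "continuous_on (square r) g" "\<And>p. p \<in> square r \<Longrightarrow> \<bar>g p\<bar> \<le> 1"
    and "\<phi> \<in> compact_smooth r"
  shows "local_zeta g \<phi> holomorphic_on {s. Re s > 0}"
  unfolding local_zeta_def[abs_def]
proof (rule holomorphic_on_parameter_integral[OF open_halfspace_Re_gt])
  fix s :: complex assume s: "s \<in> {s. 0 < Re s}"
  obtain M where M: "\<And>q. \<bar>\<phi> q\<bar> \<le> M * indicator (square r) q"
    using compact_smooth_bounded[OF assms(3)] by blast
  obtain e where "e > 0" and e: "ball s e \<subseteq> {s. 0 < Re s}"
    using s open_halfspace_Re_gt openE by blast
  have "\<forall>z\<in>ball s e. \<forall>p\<in>space lborel. norm (zeta_integrand g \<phi> z p) \<le> M * indicator (square r) p"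
  proof (intro ballI)
    fix z p assume "z \<in> ball s e"
    then have "0 \<le> Re z" using e by auto
    then show "norm (zeta_integrand g \<phi> z p) \<le> M * indicator (square r) p"
      by (intro zeta_integrand_bounded assms(2) M)
  qed
  with \<open>e > 0\<close> e show "\<exists>e B. e > 0 \<and> ball s e \<subseteq> {s. 0 < Re s} \<and> integrable lborel B \<and>
      (\<forall>z\<in>ball s e. \<forall>p\<in>space lborel. norm (zeta_integrand g \<phi> z p) \<le> B p)"
    using integrable_indicator_square by blast
qed (use borel_measurable_zeta_integrand[OF assms(1,3)] holomorphic_on_zeta_integrand in simp_all)

text \<open>The majorants below use \<open>t\<^bsup>Re z\<^esup> \<le> t\<^sup>\<sigma>\<close> for \<open>0 \<le> t \<le> 1\<close>, with one negative exponent \<open>\<sigma> > -1/a\<close> that serves a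
whole neighbourhood of \<open>s\<close>.\<close>

lemma ex_exponent_below:
  assumes "1 \<le> a" "- (1 / real a) < Re s"
  shows "\<exists>\<sigma> e. - (1 / real a) < \<sigma> \<and> \<sigma> < 0 \<and> 0 < e \<and> e \<le> 1 \<and> (\<forall>z\<in>ball s e. \<sigma> < Re z)"
proof -
  define m where "m = min 0 (Re s)"
  define \<sigma> where "\<sigma> = (m - 1 / real a) / 2"
  have m: "- (1 / real a) < m" "m \<le> 0" "m \<le> Re s"
    using assms by (auto simp: m_def)
  have "0 < 1 / real a" using assms(1) by simp
  then have \<sigma>: "- (1 / real a) < \<sigma>" "\<sigma> < 0" "\<sigma> < m"
    using m by (auto simp: \<sigma>_def)
  let ?e = "min 1 (m - \<sigma>)"
  have "\<sigma> < Re z" if "z \<in> ball s ?e" for z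
  proof -
    have "\<bar>Re s - Re z\<bar> \<le> dist s z"
      using abs_Re_le_cmod[of "s - z"] by (simp add: dist_norm)
    then show ?thesis using that m by (simp add: ) linarith
  qed
  then show ?thesis using \<sigma> by (intro exI[of _ \<sigma>] exI[of _ ?e]) auto
qed

text \<open>The weight \<open>y\<^sup>k\<close> compensates the singularity along \<open>y = 0\<close>: since \<open>b \<sigma> > -b/a \<ge> -(k+1)\<close>, the exponent
\<open>k + b \<sigma>\<close> of \<open>\<bar>y\<bar>\<close> exceeds \<open>-1\<close>.\<close>

lemma local_zeta_weighted_holomorphic:
  assumes "1 \<le> a" "0 < r" "0 < c" "b \<le> (k + 1) * a"
    and "continuous_on (square r) g" "\<And>p. p \<in> square r \<Longrightarrow> \<bar>g p\<bar> \<le> 1"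
    and "\<And>x. g (x, 0) = 0"
    and "x_derivative_bound r a b c g" "\<phi> \<in> compact_smooth r"
  shows "local_zeta g (\<lambda>q. snd q ^ k * \<phi> q) holomorphic_on {s. Re s > - (1 / real a)}"
  unfolding local_zeta_def[abs_def]
proof (rule holomorphic_on_parameter_integral[OF open_halfspace_Re_gt])
  have smooth_weight: "smooth_on (square r) (\<lambda>q. snd q ^ k)"
    using open_square by (intro smooth_on_power smooth_on_bounded_linear bounded_linear_snd)
  have "(\<lambda>q. snd q ^ k * \<phi> q) \<in> compact_smooth r"
    using compact_smooth_mult[OF assms(9) smooth_weight] by (simp only: mult.commute)
  then show "zeta_integrand g (\<lambda>q. snd q ^ k * \<phi> q) s \<in> borel_measurable lborel" for s
    using borel_measurable_zeta_integrand[OF assms(5)] by simp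
  fix s :: complex assume s: "s \<in> {s. - (1 / real a) < Re s}"
  obtain M where "M \<ge> 0" and M: "\<And>q. \<bar>\<phi> q\<bar> \<le> M * indicator (square r) q"
    using compact_smooth_bounded[OF assms(9)] by blast
  obtain \<sigma> e where \<sigma>: "- (1 / real a) < \<sigma>" "\<sigma> < 0" "0 < e" and e: "\<And>z. z \<in> ball s e \<Longrightarrow> \<sigma> < Re z"
    using ex_exponent_below[OF assms(1)] s by blast
  let ?B = "\<lambda>p. M * (indicator (square r) p * (\<bar>snd p\<bar> powr real k * \<bar>g p\<bar> powr \<sigma>))"
  have int: "integrable lborel ?B"
  proof (intro integrable_mult_right integrable_weighted_powr[OF assms(1) \<sigma>(1,2) assms(2,3) _ assms(5,8)])
    have "real b \<le> (real k + 1) * real a"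
      using assms(4) by (metis of_nat_1 of_nat_add of_nat_le_iff of_nat_mult)
    then have "real b / real a \<le> real k + 1"
      using assms(1) by (simp add: field_simps)
    show "- 1 < real k + real b * \<sigma>"
    proof (cases "b = 0")
      case False
      have "real b * \<sigma> > real b * - (1 / real a)"
        using \<sigma>(1) False by (intro mult_strict_left_mono) auto
      with \<open>real b / real a \<le> real k + 1\<close> show ?thesis by simp
    qed simp
  qed
  have "norm (zeta_integrand g (\<lambda>q. snd q ^ k * \<phi> q) z p) \<le> ?B p" if z: "z \<in> ball s e" for z p
  proof (cases "p \<in> square r \<and> g p \<noteq> 0")
    case True
    then have "snd p \<noteq> 0" using assms(7) by (cases p) auto
    then have "\<bar>snd p ^ k\<bar> = \<bar>snd p\<bar> powr real k"
      by (simp add: powr_realpow power_abs)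
    moreover have "\<bar>g p\<bar> powr Re z \<le> \<bar>g p\<bar> powr \<sigma>"
      using True assms(6)[of p] e[OF z] by (intro powr_mono') auto
    moreover have "\<bar>\<phi> p\<bar> \<le> M" using M[of p] True by simp
    ultimately have "\<bar>g p\<bar> powr Re z * \<bar>snd p ^ k * \<phi> p\<bar> \<le> \<bar>g p\<bar> powr \<sigma> * (\<bar>snd p\<bar> powr real k * M)"
      by (simp add: abs_mult mult_mono mult_left_mono)
    then show ?thesis using True by (simp add: norm_zeta_integrand mult_ac)
  next
    case False
    then show ?thesis
      using compact_smooth_zero_outside[OF assms(9), of p] \<open>M \<ge> 0\<close>
      by (cases "p \<in> square r") (auto simp: zeta_integrand_def)
  qed
  moreover have "ball s e \<subseteq> {s. - (1 / real a) < Re s}"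
    using e \<sigma>(1) by force
  ultimately show "\<exists>e B. e > 0 \<and> ball s e \<subseteq> {s. - (1 / real a) < Re s} \<and> integrable lborel B \<and>
      (\<forall>z\<in>ball s e. \<forall>p\<in>space lborel. norm (zeta_integrand g (\<lambda>q. snd q ^ k * \<phi> q) z p) \<le> B p)"
    using int \<sigma>(3) by blast
qed (rule holomorphic_on_zeta_integrand)

text \<open>Here flatness enters: \<open>\<bar>f - g\<bar>\<^sup>\<theta> \<le> C \<bar>y\<bar>\<^bsup>n\<theta>\<^esup>\<close> for every \<open>n\<close>, and \<open>n\<close> is chosen so large that this factor
compensates \<open>\<bar>y\<bar>\<^bsup>b\<tau>\<^esup>\<close>, where \<open>\<tau> = \<sigma> - \<theta>\<close> is still greater than \<open>-1/a\<close>.\<close>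

lemma zeta_difference_holomorphic:
  assumes "1 \<le> a" "0 < r" "0 < c"
    and "continuous_on (square r) f" "\<And>p. p \<in> square r \<Longrightarrow> \<bar>f p\<bar> \<le> 1" "x_derivative_bound r a b c f"
    and "continuous_on (square r) g" "\<And>p. p \<in> square r \<Longrightarrow> \<bar>g p\<bar> \<le> 1" "x_derivative_bound r a b c g"
    and flat: "\<And>n. \<exists>C. \<forall>p\<in>square r. \<bar>f p - g p\<bar> \<le> C * \<bar>snd p\<bar> ^ n"
    and "\<phi> \<in> compact_smooth r"
  shows "(\<lambda>s. \<integral>p. zeta_integrand f \<phi> s p - zeta_integrand g \<phi> s p \<partial>lborel)
    holomorphic_on {s. Re s > - (1 / real a)}"
proof (rule holomorphic_on_parameter_integral[OF open_halfspace_Re_gt])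
  show "(\<lambda>p. zeta_integrand f \<phi> s p - zeta_integrand g \<phi> s p) \<in> borel_measurable lborel" for s
    using borel_measurable_zeta_integrand[OF assms(4,11)] borel_measurable_zeta_integrand[OF assms(7,11)]
    by simp
  fix s :: complex assume s: "s \<in> {s. - (1 / real a) < Re s}"
  obtain M where "M \<ge> 0" and M: "\<And>q. \<bar>\<phi> q\<bar> \<le> M * indicator (square r) q"
    using compact_smooth_bounded[OF assms(11)] by blast
  obtain \<sigma> e where \<sigma>: "- (1 / real a) < \<sigma>" "\<sigma> < 0" "0 < e" "e \<le> 1"
    and e: "\<And>z. z \<in> ball s e \<Longrightarrow> \<sigma> < Re z"
    using ex_exponent_below[OF assms(1)] s by blast
  \<comment> \<open>Half of the room between \<open>-1/a\<close> and \<open>\<sigma>\<close> is spent on \<open>\<theta>\<close>.\<close>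
  define \<theta> where "\<theta> = (\<sigma> + 1 / real a) / 2"
  define \<tau> where "\<tau> = \<sigma> - \<theta>"
  have "1 / real a \<le> 1" using assms(1) by simp
  then have \<theta>: "0 < \<theta>" "\<theta> \<le> 1" using \<sigma> by (auto simp: \<theta>_def)
  have "- (1 / real a) < \<tau>"
    using \<sigma>(1) unfolding \<tau>_def \<theta>_def by argo
  moreover have "\<tau> < 0"
    using \<sigma>(2) \<theta>(1) unfolding \<tau>_def by linarith
  ultimately have \<tau>: "- (1 / real a) < \<tau>" "\<tau> < 0" by auto
  obtain n :: nat where n: "real b / \<theta> < real n"
    using reals_Archimedean2 by blast
  obtain C where C: "\<And>p. p \<in> square r \<Longrightarrow> \<bar>f p - g p\<bar> \<le> C * \<bar>snd p\<bar> ^ n"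
    using flat by blast
  define \<kappa> where "\<kappa> = real n * \<theta>"
  define P where "P h p = indicator (square r) p * (\<bar>snd p\<bar> powr \<kappa> * \<bar>h p\<bar> powr \<tau>)"
    for h :: "real \<times> real \<Rightarrow> real" and p
  have weight: "-1 < \<kappa> + real b * \<tau>"
  proof -
    have "\<tau> > - 1" using \<tau>(1) \<open>1 / real a \<le> 1\<close> by linarith
    then have "real b * \<tau> \<ge> real b * (-1)"
      by (intro mult_left_mono) auto
    moreover have "real b < \<kappa>"
      using n \<theta>(1) by (simp add: \<kappa>_def field_simps)
    ultimately show ?thesis by linarith
  qed
  let ?A = "(2 + (norm s + 1)) * (\<bar>C\<bar> powr \<theta> * M)"
  let ?B = "\<lambda>p. ?A * (P f p + P g p)"
  have "integrable lborel (P f)"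
    unfolding P_def by (rule integrable_weighted_powr[OF assms(1) \<tau> assms(2,3) weight assms(4,6)])
  moreover have "integrable lborel (P g)"
    unfolding P_def by (rule integrable_weighted_powr[OF assms(1) \<tau> assms(2,3) weight assms(7,9)])
  ultimately have int: "integrable lborel ?B"
    by (intro integrable_mult_right Bochner_Integration.integrable_add)
  have "norm (zeta_integrand f \<phi> z p - zeta_integrand g \<phi> z p) \<le> ?B p" if z: "z \<in> ball s e" for z p
  proof (cases "p \<in> square r")
    case True
    have lower: "t powr (Re z - \<theta>) \<le> t powr \<tau>" if "0 \<le> t" "t \<le> 1" for t
    proof (cases "t = 0")
      case False
      then show ?thesis using that e[OF z] by (intro powr_mono') (auto simp: \<tau>_def)
    qed simp
    have "norm z \<le> norm s + dist s z"
      by (metis dist_commute dist_norm norm_triangle_sub)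
    then have "norm z \<le> norm s + 1"
      using z \<sigma>(4) by simp
    have gap: "\<bar>\<bar>f p\<bar> - \<bar>g p\<bar>\<bar> powr \<theta> \<le> \<bar>C\<bar> powr \<theta> * \<bar>snd p\<bar> powr \<kappa>"
    proof -
      have "\<bar>\<bar>f p\<bar> - \<bar>g p\<bar>\<bar> \<le> \<bar>f p - g p\<bar>" by linarith
      also have "\<dots> \<le> C * \<bar>snd p\<bar> ^ n" by (rule C[OF True])
      also have "\<dots> \<le> \<bar>C\<bar> * \<bar>snd p\<bar> ^ n" by (intro mult_right_mono) auto
      finally have "\<bar>\<bar>f p\<bar> - \<bar>g p\<bar>\<bar> powr \<theta> \<le> (\<bar>C\<bar> * \<bar>snd p\<bar> ^ n) powr \<theta>"
        using \<theta>(1) by (intro powr_mono2) auto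
      also have "\<dots> = \<bar>C\<bar> powr \<theta> * (\<bar>snd p\<bar> ^ n) powr \<theta>"
        by (rule powr_mult)
      also have "(\<bar>snd p\<bar> ^ n) powr \<theta> \<le> \<bar>snd p\<bar> powr \<kappa>"
      proof (cases "snd p = 0")
        case True
        \<comment> \<open>At \<open>y = 0\<close> the power \<open>\<bar>y\<bar>\<^sup>n\<close> has to vanish, which needs \<open>n > 0\<close>.\<close>
        have "0 < real n"
          by (rule le_less_trans[OF _ n]) (use \<theta>(1) in simp)
        then show ?thesis by (simp add: True)
      next
        case False
        then show ?thesis by (simp add: \<kappa>_def powr_realpow[symmetric] powr_powr)
      qed
      finally show ?thesis by (simp add: mult_left_mono)
    qed
    have "norm (zeta_integrand f \<phi> z p - zeta_integrand g \<phi> z p) =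
        norm (complex_of_real \<bar>f p\<bar> powr z - complex_of_real \<bar>g p\<bar> powr z) * \<bar>\<phi> p\<bar>"
      by (simp add: zeta_integrand_def norm_mult flip: left_diff_distrib)
    also have "\<dots> \<le> ((2 + norm z) * \<bar>\<bar>f p\<bar> - \<bar>g p\<bar>\<bar> powr \<theta> *
        (\<bar>f p\<bar> powr (Re z - \<theta>) + \<bar>g p\<bar> powr (Re z - \<theta>))) * M"
      using M[of p] True \<theta> by (intro mult_mono norm_powr_diff_le) auto
    also have "\<dots> \<le> ((2 + (norm s + 1)) * (\<bar>C\<bar> powr \<theta> * \<bar>snd p\<bar> powr \<kappa>) *
        (\<bar>f p\<bar> powr \<tau> + \<bar>g p\<bar> powr \<tau>)) * M"
      using \<open>norm z \<le> norm s + 1\<close> \<open>M \<ge> 0\<close> assms(5,8) True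
      by (intro mult_right_mono[OF _ \<open>M \<ge> 0\<close>] mult_mono gap add_mono lower) auto
    also have "\<dots> = ?B p"
      using True by (simp add: P_def algebra_simps)
    finally show ?thesis .
  next
    case False
    then show ?thesis
      using compact_smooth_zero_outside[OF assms(11)] by (simp add: zeta_integrand_def P_def)
  qed
  moreover have "ball s e \<subseteq> {s. - (1 / real a) < Re s}"
    using e \<sigma>(1) by force
  ultimately show "\<exists>e B. e > 0 \<and> ball s e \<subseteq> {s. - (1 / real a) < Re s} \<and> integrable lborel B \<and>
      (\<forall>z\<in>ball s e. \<forall>p\<in>space lborel.
         norm (zeta_integrand f \<phi> z p - zeta_integrand g \<phi> z p) \<le> B p)"
    using int \<sigma>(3) by blast
qed (intro holomorphic_on_diff holomorphic_on_zeta_integrand)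

section \<open>Integration by parts\<close>

lemma has_real_derivative_abs:
  fixes m :: "real \<Rightarrow> real"
  assumes "(m has_real_derivative d) (at y)" "m y \<noteq> 0"
  shows "((\<lambda>t. \<bar>m t\<bar>) has_real_derivative sgn (m y) * d) (at y)"
proof -
  have square: "((\<lambda>t. (m t)\<^sup>2) has_real_derivative 2 * m y * d) (at y)"
    using DERIV_power[OF assms(1), of 2] by (simp add: mult_ac)
  have "((\<lambda>t. sqrt ((m t)\<^sup>2)) has_real_derivative inverse (sqrt ((m y)\<^sup>2)) / 2 * (2 * m y * d)) (at y)"
    by (rule DERIV_chain2[OF DERIV_real_sqrt square]) (use assms(2) in simp)
  moreover have eq: "inverse (sqrt ((m y)\<^sup>2)) / 2 * (2 * m y * d) = sgn (m y) * d"
    using assms(2) by (simp add: sgn_real_def field_simps)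
  ultimately show ?thesis by (simp only: eq real_sqrt_abs)
qed

text \<open>Stated with the logarithmic derivative \<open>l\<close> of \<open>m\<close>, the derivative of the power is again a multiple of the
same power.\<close>

lemma has_vector_derivative_abs_powr:
  fixes m :: "real \<Rightarrow> real"
  assumes "(m has_real_derivative m y * l) (at y)" "m y \<noteq> 0"
  shows "((\<lambda>t. complex_of_real \<bar>m t\<bar> powr s) has_vector_derivative
    s * complex_of_real l * complex_of_real \<bar>m y\<bar> powr s) (at y)"
proof -
  have "((\<lambda>t. \<bar>m t\<bar>) has_vector_derivative \<bar>m y\<bar> * l) (at y)"
    using has_real_derivative_abs[OF assms]
    by (simp add: has_real_derivative_iff_has_vector_derivative abs_sgn mult_ac)
  moreover have "((\<lambda>t. complex_of_real t powr s) has_vector_derivative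
      s * complex_of_real \<bar>m y\<bar> powr (s - 1)) (at \<bar>m y\<bar>)"
    using assms(2) by (intro has_vector_derivative_of_real_powr) simp
  ultimately have "((\<lambda>t. complex_of_real \<bar>m t\<bar> powr s) has_vector_derivative
      (\<bar>m y\<bar> * l) *\<^sub>R (s * complex_of_real \<bar>m y\<bar> powr (s - 1))) (at y)"
    by (rule vector_diff_chain_at[unfolded o_def])
  moreover have "(\<bar>m y\<bar> * l) *\<^sub>R (s * complex_of_real \<bar>m y\<bar> powr (s - 1)) =
      s * complex_of_real l * complex_of_real \<bar>m y\<bar> powr s"
  proof -
    have "complex_of_real \<bar>m y\<bar> powr (s - 1) * complex_of_real \<bar>m y\<bar> = complex_of_real \<bar>m y\<bar> powr s"
      using assms(2) by (simp add: powr_diff)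
    then show ?thesis by (simp add: scaleR_conv_of_real mult_ac)
  qed
  ultimately show ?thesis by simp
qed

text \<open>The exceptional point \<open>0\<close> is where \<open>\<bar>g(x, _)\<bar>\<^sup>s\<close> may fail to be differentiable when \<open>Re s\<close> is small; continuity
suffices there.\<close>

lemma integral_eq_0_of_compact_antiderivative:
  fixes w \<Psi> :: "real \<Rightarrow> complex"
  assumes "0 < r" "integrable lborel w" "\<And>y. r \<le> \<bar>y\<bar> \<Longrightarrow> w y = 0 \<and> \<Psi> y = 0"
    and "\<And>y. y \<noteq> 0 \<Longrightarrow> (\<Psi> has_vector_derivative w y) (at y)"
    and "isCont \<Psi> 0"
  shows "integral\<^sup>L lborel w = 0"
proof -
  have "isCont \<Psi> y" for y
    using assms(4)[of y] assms(5) has_vector_derivative_continuous by (cases "y = 0") auto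
  then have "(w has_integral (\<Psi> r - \<Psi> (-r))) {-r..r}"
    using assms(1,4)
    by (intro fundamental_theorem_of_calculus_strong[where S = "{0}"] continuous_at_imp_continuous_on) auto
  then have "(w has_integral 0) {-r..r}"
    using assms(1,3) by simp
  then have "(w has_integral 0) UNIV"
    by (rule has_integral_on_superset) (use assms(3) in auto)
  moreover have "(w has_integral integral\<^sup>L lborel w) UNIV"
    by (rule has_integral_integral_lborel[OF assms(2)])
  ultimately show ?thesis by (rule has_integral_unique[rotated])
qed

text \<open>For fixed \<open>x \<noteq> 0\<close> the logarithmic derivative of \<open>g = v x\<^sup>a y\<^sup>b\<close> in \<open>y\<close> is \<open>v\<^sub>y / v + b / y\<close>.  Therefore the \<open>y\<close>-derivative
of \<open>\<bar>g\<bar>\<^sup>s y\<^bsup>k+1\<^esup> \<phi>\<close> is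
\<open>\<bar>g\<bar>\<^sup>s ((b s + k + 1) y\<^sup>k \<phi> + s y\<^bsup>k+1\<^esup> \<phi> v\<^sub>y / v + y\<^bsup>k+1\<^esup> \<phi>\<^sub>y)\<close>, and its integral over each vertical line is zero.\<close>

lemma local_zeta_integration_by_parts:
  fixes v \<phi> :: "real \<times> real \<Rightarrow> real" and s :: complex and a b k :: nat
  defines "g \<equiv> \<lambda>p. v p * fst p ^ a * snd p ^ b"
  assumes "0 < r" "smooth_on (square r) v" "\<And>p. p \<in> square r \<Longrightarrow> 0 < v p"
    and "\<And>p. p \<in> square r \<Longrightarrow> \<bar>g p\<bar> \<le> 1" "1 \<le> a"
    and \<phi>: "\<phi> \<in> compact_smooth r" and s: "0 < Re s"
  shows "(of_nat b * s + of_nat (Suc k)) * local_zeta g (\<lambda>q. snd q ^ k * \<phi> q) s =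
    - (s * local_zeta g (\<lambda>q. snd q ^ Suc k * (\<phi> q * (partial_y v q / v q))) s +
       local_zeta g (\<lambda>q. snd q ^ Suc k * partial_y \<phi> q) s)"
proof -
  define l where "l q = partial_y v q / v q" for q
  have smooth_l: "smooth_on (square r) l"
    unfolding l_def using assms(3,4)
    by (intro smooth_on_divide open_square smooth_on_directional_derivative) force+
  have power: "(\<lambda>q. snd q ^ n * \<psi> q) \<in> compact_smooth r" if "\<psi> \<in> compact_smooth r" for n \<psi>
    using compact_smooth_mult[OF that smooth_on_power[OF open_square
          smooth_on_bounded_linear[OF bounded_linear_snd], of r n]]
    by (simp only: mult.commute)
  have cont_g: "continuous_on (square r) g"
    unfolding g_def using smooth_on_imp_continuous_on[OF assms(3)]
    by (intro continuous_intros)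
  define W where "W q = (of_nat b * s + of_nat (Suc k)) * zeta_integrand g (\<lambda>q. snd q ^ k * \<phi> q) s q +
      (s * zeta_integrand g (\<lambda>q. snd q ^ Suc k * (\<phi> q * l q)) s q +
       zeta_integrand g (\<lambda>q. snd q ^ Suc k * partial_y \<phi> q) s q)" for q
  have int: "integrable lborel (zeta_integrand g (\<lambda>q. snd q ^ n * \<psi> q) s)" if "\<psi> \<in> compact_smooth r" for n \<psi>
    using s by (intro integrable_zeta_integrand[OF cont_g assms(5) power[OF that]]) auto
  note ints = int[OF \<phi>, of k] int[OF compact_smooth_mult[OF \<phi> smooth_l], of "Suc k"]
    int[OF compact_smooth_directional_derivative[OF \<phi>], of "Suc k" "(0, 1)"]
  have int_W: "integrable lborel W"
    unfolding W_def using ints by (intro Bochner_Integration.integrable_add integrable_mult_right)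
  have eval: "integral\<^sup>L lborel W =
      (of_nat b * s + of_nat (Suc k)) * local_zeta g (\<lambda>q. snd q ^ k * \<phi> q) s +
      (s * local_zeta g (\<lambda>q. snd q ^ Suc k * (\<phi> q * l q)) s +
       local_zeta g (\<lambda>q. snd q ^ Suc k * partial_y \<phi> q) s)"
    unfolding W_def local_zeta_def using ints by simp
  obtain K where K: "compact K" "K \<subseteq> square r" "\<And>q. q \<notin> K \<Longrightarrow> \<phi> q = 0"
    using \<phi> unfolding compact_smooth_def by blast
  obtain M where "M \<ge> 0" and M: "\<And>q. \<bar>\<phi> q\<bar> \<le> M * indicator (square r) q"
    using compact_smooth_bounded[OF \<phi>] by blast
  have W_eq: "W (x, y) = complex_of_real \<bar>g (x, y)\<bar> powr s *
      ((of_nat b * s + of_nat (Suc k)) * of_real (y ^ k * \<phi> (x, y)) +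
       s * of_real (y ^ Suc k * (\<phi> (x, y) * l (x, y))) + of_real (y ^ Suc k * partial_y \<phi> (x, y)))" for x y
    by (simp add: W_def zeta_integrand_def algebra_simps)
  have W_0: "W q = 0" if "q \<notin> K" for q
    using that K(3) directional_derivative_eq_0_outside[OF compact_imp_closed[OF K(1)] K(3) that]
    by (simp add: W_def zeta_integrand_def)
  have slice: "(\<integral>y. W (x, y) \<partial>lborel) = 0" if "integrable lborel (\<lambda>y. W (x, y))" for x
  proof (cases "x = 0")
    case True
    then have "W (x, y) = 0" for y
      using assms(6) by (simp add: W_eq g_def)
    then show ?thesis by simp
  next
    case False
    define \<Psi> where "\<Psi> y = complex_of_real \<bar>g (x, y)\<bar> powr s * of_real (y ^ Suc k * \<phi> (x, y))" for y
    show ?thesis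
    proof (rule integral_eq_0_of_compact_antiderivative[OF assms(2) that])
      show "W (x, y) = 0 \<and> \<Psi> y = 0" if "r \<le> \<bar>y\<bar>" for y
      proof -
        have "(x, y) \<notin> K" using that K(2) by (auto simp: mem_square_iff)
        then show ?thesis using W_0 K(3) by (simp add: \<Psi>_def)
      qed
      \<comment> \<open>Continuity at \<open>0\<close> comes from the factor \<open>y\<^bsup>k+1\<^esup>\<close>, as \<open>\<bar>g\<bar>\<^sup>s\<close> is bounded by \<open>1\<close>.\<close>
      have "norm (\<Psi> y) \<le> M * \<bar>y\<bar> ^ Suc k" for y
      proof (cases "(x, y) \<in> square r")
        case True
        have "\<bar>g (x, y)\<bar> powr Re s \<le> 1"
          using assms(5)[OF True] s by (intro powr_le1) auto
        moreover have "\<bar>\<phi> (x, y)\<bar> \<le> M" using M[of "(x, y)"] True by simp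
        ultimately have "\<bar>g (x, y)\<bar> powr Re s * (\<bar>y\<bar> ^ Suc k * \<bar>\<phi> (x, y)\<bar>) \<le> 1 * (\<bar>y\<bar> ^ Suc k * M)"
          by (intro mult_mono mult_left_mono) auto
        then show ?thesis
          by (simp add: \<Psi>_def norm_mult norm_of_real_powr_complex abs_mult power_abs norm_power mult_ac)
      next
        case False
        with K(2,3) have "\<phi> (x, y) = 0" by blast
        then show ?thesis using \<open>M \<ge> 0\<close> by (simp add: \<Psi>_def)
      qed
      moreover have "((\<lambda>y. M * \<bar>y\<bar> ^ Suc k) \<longlongrightarrow> 0) (at 0)"
        by (auto intro!: tendsto_eq_intros)
      ultimately have "(\<Psi> \<longlongrightarrow> 0) (at 0)"
        by (intro Lim_null_comparison[of \<Psi> "\<lambda>y. M * \<bar>y\<bar> ^ Suc k"] always_eventually allI)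
      moreover have "\<Psi> 0 = 0" by (simp add: \<Psi>_def)
      ultimately show "isCont \<Psi> 0" by (simp add: isCont_def)
      show "(\<Psi> has_vector_derivative W (x, y)) (at y)" if "y \<noteq> 0" for y
      proof (cases "(x, y) \<in> K")
        case False
        have "open (Pair x -` (- K))"
          using compact_imp_closed[OF K(1)]
          by (intro open_vimage continuous_intros) auto
        moreover have "y \<in> Pair x -` (- K)" using False by simp
        moreover have "0 = \<Psi> t" if "t \<in> Pair x -` (- K)" for t
          using that K(3) by (simp add: \<Psi>_def)
        ultimately have "(\<Psi> has_vector_derivative 0) (at y)"
          by (rule has_vector_derivative_transform_within_open[OF has_vector_derivative_const])
        then show ?thesis by (simp add: W_0[OF False])
      next
        case True
        then have sq: "(x, y) \<in> square r" using K(2) by blast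
        have v: "((\<lambda>t. v (x, t)) has_real_derivative partial_y v (x, y)) (at y)"
          by (rule has_real_derivative_partial_y[OF smooth_on_imp_differentiable[OF assms(3) sq]])
        have \<phi>_der: "((\<lambda>t. \<phi> (x, t)) has_real_derivative partial_y \<phi> (x, y)) (at y)"
          using \<phi> sq unfolding compact_smooth_def
          by (intro has_real_derivative_partial_y smooth_on_imp_differentiable[of "square r"]) auto
        have v_pos: "v (x, y) > 0" using assms(4)[OF sq] .
        have g_der: "((\<lambda>t. g (x, t)) has_real_derivative g (x, y) * (l (x, y) + real b / y)) (at y)"
        proof -
          have "((\<lambda>t. v (x, t) * x ^ a * t ^ b) has_real_derivative
              (partial_y v (x, y) * x ^ a) * y ^ b + (real b * y ^ (b - Suc 0)) * (v (x, y) * x ^ a)) (at y)"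
            by (intro DERIV_mult DERIV_cmult_right v DERIV_pow)
          moreover have "(partial_y v (x, y) * x ^ a) * y ^ b + (real b * y ^ (b - Suc 0)) * (v (x, y) * x ^ a) =
              g (x, y) * (l (x, y) + real b / y)"
            using v_pos that by (cases b) (auto simp: g_def l_def field_simps)
          ultimately show ?thesis by (simp add: g_def)
        qed
        have g_ne: "g (x, y) \<noteq> 0"
          using v_pos that False by (simp add: g_def)
        note A = has_vector_derivative_abs_powr[OF g_der g_ne, of s]
        have B: "((\<lambda>t. t ^ Suc k * \<phi> (x, t)) has_real_derivative
            (real (Suc k) * y ^ k) * \<phi> (x, y) + partial_y \<phi> (x, y) * y ^ Suc k) (at y)"
          using DERIV_mult[OF DERIV_pow[of "Suc k" y] \<phi>_der] by simp
        have B': "((\<lambda>t. complex_of_real (t ^ Suc k * \<phi> (x, t))) has_vector_derivative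
            complex_of_real ((real (Suc k) * y ^ k) * \<phi> (x, y) + partial_y \<phi> (x, y) * y ^ Suc k)) (at y)"
          using B by (rule has_vector_derivative_of_real)
        have "(\<Psi> has_vector_derivative
            complex_of_real \<bar>g (x, y)\<bar> powr s *
              complex_of_real ((real (Suc k) * y ^ k) * \<phi> (x, y) + partial_y \<phi> (x, y) * y ^ Suc k) +
            s * complex_of_real (l (x, y) + real b / y) * complex_of_real \<bar>g (x, y)\<bar> powr s *
              complex_of_real (y ^ Suc k * \<phi> (x, y))) (at y)"
          unfolding \<Psi>_def by (rule has_vector_derivative_mult[OF A B'])
        moreover have "complex_of_real \<bar>g (x, y)\<bar> powr s *
              complex_of_real ((real (Suc k) * y ^ k) * \<phi> (x, y) + partial_y \<phi> (x, y) * y ^ Suc k) +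
            s * complex_of_real (l (x, y) + real b / y) * complex_of_real \<bar>g (x, y)\<bar> powr s *
              complex_of_real (y ^ Suc k * \<phi> (x, y)) = W (x, y)"
          unfolding W_eq using that by (simp add: field_simps)
        ultimately show ?thesis by simp
      qed
    qed
  qed
  have "integral\<^sup>L lborel W = (\<integral>x. \<integral>y. W (x, y) \<partial>lborel \<partial>lborel)"
    using lborel_pair.integral_fst'[of W] int_W by (simp add: lborel_prod)
  also have "\<dots> = (\<integral>x. 0 \<partial>(lborel :: real measure))"
  proof (rule integral_cong_AE)
    have "AE x in lborel. integrable lborel (\<lambda>y. W (x, y))"
      using lborel_pair.AE_integrable_fst'[of W] int_W by (simp add: lborel_prod)
    then show "AE x in lborel. (\<integral>y. W (x, y) \<partial>lborel) = 0"
      by eventually_elim (rule slice)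
    have "W \<in> borel_measurable (lborel \<Otimes>\<^sub>M lborel)"
      using int_W by (simp add: lborel_prod)
    then show "(\<lambda>x. \<integral>y. W (x, y) \<partial>lborel) \<in> borel_measurable lborel"
      using lborel.borel_measurable_lebesgue_integral[of "\<lambda>x y. W (x, y)" lborel] by simp
  qed simp
  finally have "integral\<^sup>L lborel W = 0" by simp
  then show ?thesis
    unfolding eval l_def by (simp only: eq_neg_iff_add_eq_0)
qed

section \<open>Meromorphic continuation\<close>

text \<open>Downward induction on \<open>k\<close>.  For \<open>k = N\<close> the integral converges on the whole half-plane; each integration by parts
lowers \<open>k\<close> by one and costs the factor \<open>b s + k + 1\<close>.  Keeping the denominators multiplied out
leaves only holomorphic functions to handle.\<close>

lemma monomial_zeta_numerator:
  fixes v :: "real \<times> real \<Rightarrow> real" and a b N :: nat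
  defines "g \<equiv> \<lambda>p. v p * fst p ^ a * snd p ^ b"
  assumes "1 \<le> a" "1 \<le> b" "b \<le> (N + 1) * a" "0 < r" "0 < c"
    and "smooth_on (square r) v" "\<And>p. p \<in> square r \<Longrightarrow> 0 < v p"
    and "\<And>p. p \<in> square r \<Longrightarrow> \<bar>g p\<bar> \<le> 1" "x_derivative_bound r a b c g"
    and "k \<le> N" "\<phi> \<in> compact_smooth r"
  shows "\<exists>A. A holomorphic_on {s. Re s > - (1 / real a)} \<and>
    (\<forall>s. Re s > 0 \<longrightarrow>
      (\<Prod>j\<in>{k<..N}. of_nat b * s + of_nat j) * local_zeta g (\<lambda>q. snd q ^ k * \<phi> q) s = A s)"
  using assms(11,12)
proof (induction k arbitrary: \<phi> rule: inc_induct)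
  case base
  have "continuous_on (square r) g"
    unfolding g_def using smooth_on_imp_continuous_on[OF assms(7)]
    by (intro continuous_intros)
  then have "local_zeta g (\<lambda>q. snd q ^ N * \<phi> q) holomorphic_on {s. Re s > - (1 / real a)}"
    using assms(3)
    by (intro local_zeta_weighted_holomorphic[OF assms(2,5,6,4) _ assms(9) _ assms(10) base])
       (simp_all add: g_def)
  then show ?case by (intro exI[of _ "local_zeta g (\<lambda>q. snd q ^ N * \<phi> q)"]) simp
next
  case (step k)
  let ?l = "\<lambda>q. partial_y v q / v q"
  let ?Q = "\<lambda>s. \<Prod>j\<in>{Suc k<..N}. of_nat b * s + of_nat j :: complex"
  have "smooth_on (square r) ?l"
    using assms(7,8) by (intro smooth_on_divide open_square smooth_on_directional_derivative) force+
  then have l: "(\<lambda>q. \<phi> q * ?l q) \<in> compact_smooth r"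
    by (rule compact_smooth_mult[OF step.prems])
  obtain A1 where A1: "A1 holomorphic_on {s. Re s > - (1 / real a)}"
    "\<forall>s. Re s > 0 \<longrightarrow> ?Q s * local_zeta g (\<lambda>q. snd q ^ Suc k * (\<phi> q * ?l q)) s = A1 s"
    using step.IH[OF l] by blast
  obtain A2 where A2: "A2 holomorphic_on {s. Re s > - (1 / real a)}"
    "\<forall>s. Re s > 0 \<longrightarrow> ?Q s * local_zeta g (\<lambda>q. snd q ^ Suc k * partial_y \<phi> q) s = A2 s"
    using step.IH[OF compact_smooth_directional_derivative[OF step.prems]] by blast
  have "(\<lambda>s. - (s * A1 s + A2 s)) holomorphic_on {s. Re s > - (1 / real a)}"
    using A1(1) A2(1) by (intro holomorphic_intros)
  moreover have "(\<Prod>j\<in>{k<..N}. of_nat b * s + of_nat j) * local_zeta g (\<lambda>q. snd q ^ k * \<phi> q) s =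
      - (s * A1 s + A2 s)" if "Re s > 0" for s
  proof -
    have "{k<..N} = insert (Suc k) {Suc k<..N}" using step.hyps by auto
    then have "(\<Prod>j\<in>{k<..N}. of_nat b * s + of_nat j) * local_zeta g (\<lambda>q. snd q ^ k * \<phi> q) s =
        ?Q s * ((of_nat b * s + of_nat (Suc k)) * local_zeta g (\<lambda>q. snd q ^ k * \<phi> q) s)"
      by (simp add: mult_ac)
    also have "(of_nat b * s + of_nat (Suc k)) * local_zeta g (\<lambda>q. snd q ^ k * \<phi> q) s =
        - (s * local_zeta g (\<lambda>q. snd q ^ Suc k * (\<phi> q * ?l q)) s +
           local_zeta g (\<lambda>q. snd q ^ Suc k * partial_y \<phi> q) s)"
      unfolding g_def
      by (rule local_zeta_integration_by_parts[OF assms(5,7,8) assms(9)[unfolded g_def] assms(2) step.prems that])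
    also have "?Q s * - (s * local_zeta g (\<lambda>q. snd q ^ Suc k * (\<phi> q * ?l q)) s +
           local_zeta g (\<lambda>q. snd q ^ Suc k * partial_y \<phi> q) s) =
        - (s * (?Q s * local_zeta g (\<lambda>q. snd q ^ Suc k * (\<phi> q * ?l q)) s) +
           ?Q s * local_zeta g (\<lambda>q. snd q ^ Suc k * partial_y \<phi> q) s)"
      by (simp only: ring_distribs mult_ac mult_minus_right)
    also have "\<dots> = - (s * A1 s + A2 s)"
      using A1(2) A2(2) that by simp
    finally show ?thesis .
  qed
  ultimately show ?case by blast
qed

text \<open>\<open>D + A / Q\<close> is the continuation, with its values at the zeros of \<open>Q\<close> corrected by filling in removable
singularities.\<close>

lemma continuation_from_numerator:
  assumes "open H" "connected H" "{s. Re s > 0} \<subseteq> H"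
    and "D holomorphic_on H" "A holomorphic_on H" "Q holomorphic_on UNIV"
    and Z: "\<And>s. Re s > 0 \<Longrightarrow> Q s \<noteq> 0 \<and> Q s * (Z s - D s) = A s"
  shows "\<exists>F. meromorphic_continuation Z H F \<and> (\<forall>s\<in>H. is_pole F s \<longrightarrow> Q s = 0)"
proof -
  define G where "G s = D s + A s / Q s" for s
  have DA: "D analytic_on H" "A analytic_on H" "Q analytic_on UNIV"
    using assms by (simp_all add: analytic_on_open)
  have "D meromorphic_on H" "A meromorphic_on H" "Q meromorphic_on H"
    using DA by (auto intro: analytic_on_imp_meromorphic_on analytic_on_subset)
  then have G_mero: "G meromorphic_on H"
    unfolding G_def by (intro meromorphic_intros)
  have G_analytic: "G analytic_on {s}" if "s \<in> H" "Q s \<noteq> 0" for s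
    unfolding G_def using DA that
    by (intro analytic_intros) (auto intro: analytic_on_subset)
  have "remove_sings G s = Z s" if "Re s > 0" for s
  proof -
    have "s \<in> H" using that assms(3) by blast
    with Z[OF that] have "remove_sings G s = G s"
      by (intro remove_sings_at_analytic G_analytic) auto
    also have "\<dots> = Z s"
      using Z[OF that] by (simp add: G_def field_simps)
    finally show ?thesis .
  qed
  then have "meromorphic_continuation Z H (remove_sings G)"
    unfolding meromorphic_continuation_def
    using assms(1-3) remove_sings_nicely_meromorphic[OF G_mero] by blast
  moreover have "Q s = 0" if "s \<in> H" "is_pole (remove_sings G) s" for s
  proof (rule ccontr)
    assume "Q s \<noteq> 0"
    then have "remove_sings G analytic_on {s}"
      using that(1) by (intro remove_sings_analytic_on G_analytic)
    then show False using that(2) analytic_at_imp_no_pole by blast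
  qed
  ultimately show ?thesis by blast
qed

text \<open>The choice \<open>N = (b - 1) div a\<close> is the largest for which every \<open>k \<le> N\<close> satisfies \<open>k a < b\<close>, and it also satisfies
\<open>b \<le> (N + 1) a\<close>, which is what the convergence of the last integral requires.\<close>

lemma zeta_continuation:
  fixes v f :: "real \<times> real \<Rightarrow> real" and a b :: nat
  defines "g \<equiv> \<lambda>p. v p * fst p ^ a * snd p ^ b"
  assumes "1 \<le> a" "1 \<le> b" "0 < r" "0 < c"
    and "smooth_on (square r) v" "\<And>p. p \<in> square r \<Longrightarrow> 0 < v p"
    and "\<And>p. p \<in> square r \<Longrightarrow> \<bar>g p\<bar> \<le> 1" "x_derivative_bound r a b c g"
    and "continuous_on (square r) f" "\<And>p. p \<in> square r \<Longrightarrow> \<bar>f p\<bar> \<le> 1" "x_derivative_bound r a b c f"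
    and flat: "\<And>n. \<exists>C. \<forall>p\<in>square r. \<bar>f p - g p\<bar> \<le> C * \<bar>snd p\<bar> ^ n"
    and "\<phi> \<in> compact_smooth r"
  shows "\<exists>F. meromorphic_continuation (local_zeta f \<phi>) {s. Re s > - (1 / real a)} F \<and>
    (\<forall>s. Re s > - (1 / real a) \<and> is_pole F s \<longrightarrow>
      (\<exists>k. 1 \<le> k \<and> real k < real b / real a \<and> s = - complex_of_real (real k / real b)))"
proof -
  define N where "N = (b - 1) div a"
  have "b - 1 < (N + 1) * a"
    using assms(2) dividend_less_div_times[of a "b - 1"] by (simp add: N_def algebra_simps)
  then have N: "b \<le> (N + 1) * a" by simp
  have N': "real k < real b / real a" if "k \<le> N" for k
  proof -
    have "k * a \<le> N * a" using that by simp
    also have "\<dots> \<le> b - 1" by (simp add: N_def)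
    finally have "k * a < b" using assms(3) by simp
    then have "real k * real a < real b" by (metis of_nat_less_iff of_nat_mult)
    then show ?thesis using assms(2) by (simp add: field_simps)
  qed
  define H where "H = {s. Re s > - (1 / real a)}"
  define Q where "Q s = (\<Prod>j\<in>{0<..N}. of_nat b * s + of_nat j :: complex)" for s
  define D where "D s = (\<integral>p. zeta_integrand f \<phi> s p - zeta_integrand g \<phi> s p \<partial>lborel)" for s
  have cont_g: "continuous_on (square r) g"
    unfolding g_def using smooth_on_imp_continuous_on[OF assms(6)]
    by (intro continuous_intros)
  have D: "D holomorphic_on H"
    unfolding D_def H_def
    by (rule zeta_difference_holomorphic[OF assms(2,4,5,10,11,12) cont_g assms(8,9) flat assms(14)])
  obtain A where A: "A holomorphic_on H" "\<And>s. Re s > 0 \<Longrightarrow> Q s * local_zeta g \<phi> s = A s"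
    using monomial_zeta_numerator[OF assms(2,3) N assms(4-7) assms(8,9)[unfolded g_def] le0 assms(14)]
    unfolding H_def Q_def g_def by auto
  have "Q s \<noteq> 0 \<and> Q s * (local_zeta f \<phi> s - D s) = A s" if "Re s > 0" for s
  proof
    have "of_nat b * s + of_nat j \<noteq> 0" for j
    proof
      assume "of_nat b * s + of_nat j = 0"
      then have "Re (of_nat b * s + of_nat j) = 0" by simp
      then have "real b * Re s + real j = 0" by simp
      moreover have "real b * Re s > 0" using that assms(3) by simp
      ultimately show False by linarith
    qed
    then show "Q s \<noteq> 0" by (simp add: Q_def)
    have "integrable lborel (zeta_integrand f \<phi> s)" "integrable lborel (zeta_integrand g \<phi> s)"
      using that integrable_zeta_integrand[OF assms(10,11,14), of s]
        integrable_zeta_integrand[OF cont_g assms(8,14), of s] by simp_all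
    then have "local_zeta f \<phi> s - D s = local_zeta g \<phi> s"
      by (simp add: D_def local_zeta_def)
    then show "Q s * (local_zeta f \<phi> s - D s) = A s" using A(2)[OF that] by simp
  qed
  moreover have "Q holomorphic_on UNIV"
    unfolding Q_def by (intro holomorphic_intros)
  moreover have "open H" "connected H" "{s. Re s > 0} \<subseteq> H"
  proof -
    show "open H" unfolding H_def by (rule open_halfspace_Re_gt)
    show "connected H" unfolding H_def by (rule convex_connected[OF convex_halfspace_Re_gt])
    have "- (1 / real a) < Re s" if "0 < Re s" for s
      by (rule le_less_trans[OF _ that]) simp
    then show "{s. Re s > 0} \<subseteq> H" unfolding H_def by blast
  qed
  ultimately obtain F where F: "meromorphic_continuation (local_zeta f \<phi>) H F"
      "\<And>s. s \<in> H \<Longrightarrow> is_pole F s \<Longrightarrow> Q s = 0"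
    using continuation_from_numerator[of H D A Q "local_zeta f \<phi>"] D A(1) by blast
  have "\<exists>k. 1 \<le> k \<and> real k < real b / real a \<and> s = - complex_of_real (real k / real b)"
    if "s \<in> H" "is_pole F s" for s
  proof -
    have "Q s = 0" by (rule F(2)[OF that])
    then obtain k where k: "0 < k" "k \<le> N" "of_nat b * s + of_nat k = 0"
      by (auto simp: Q_def)
    then have "of_nat b * s = - of_nat k" by (simp add: eq_neg_iff_add_eq_0)
    then have "s = - complex_of_real (real k / real b)"
      using assms(3) by (simp add: field_simps)
    with k N' show ?thesis by (intro exI[of _ k]) auto
  qed
  with F(1) show ?thesis unfolding H_def by blast
qed

lemma flat_perturbation_bound:
  fixes hj :: "nat \<Rightarrow> real \<Rightarrow> real"
  assumes "\<And>j. j < a \<Longrightarrow> smooth_on S (hj j)" "\<And>j. j < a \<Longrightarrow> flat_at_origin (hj j)"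
    and "{-r..r} \<subseteq> S"
  shows "\<exists>C. \<forall>(x, y)\<in>square r. \<bar>\<Sum>j<a. x ^ j * hj j y\<bar> \<le> C * \<bar>y\<bar> ^ n"
proof -
  have "\<forall>j\<in>{..<a}. \<exists>C\<ge>0. \<forall>y\<in>{-r..r}. \<bar>hj j y\<bar> \<le> C * \<bar>y\<bar> ^ n"
    using flat_imp_power_bound[OF assms(1,2,3)] by simp
  from bchoice[OF this] obtain C where
    "\<forall>j\<in>{..<a}. C j \<ge> 0 \<and> (\<forall>y\<in>{-r..r}. \<bar>hj j y\<bar> \<le> C j * \<bar>y\<bar> ^ n)" ..
  then have C: "\<bar>hj j y\<bar> \<le> C j * \<bar>y\<bar> ^ n" if "j < a" "y \<in> {-r..r}" for j y
    using that by blast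
  have "\<bar>\<Sum>j<a. x ^ j * hj j y\<bar> \<le> (\<Sum>j<a. r ^ j * C j) * \<bar>y\<bar> ^ n" if "(x, y) \<in> square r" for x y
  proof -
    have xy: "\<bar>x\<bar> \<le> r" "y \<in> {-r..r}" using that by (auto simp: mem_square_iff abs_less_iff)
    have "\<bar>\<Sum>j<a. x ^ j * hj j y\<bar> \<le> (\<Sum>j<a. \<bar>x ^ j * hj j y\<bar>)"
      by (rule sum_abs)
    also have "\<dots> \<le> (\<Sum>j<a. r ^ j * (C j * \<bar>y\<bar> ^ n))"
      using xy C by (intro sum_mono) (auto simp: abs_mult power_abs intro!: mult_mono power_mono)
    finally show ?thesis by (simp only: sum_distrib_right mult.assoc)
  qed
  then show ?thesis by (intro exI[of _ "\<Sum>j<a. r ^ j * C j"]) auto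
qed

lemma m0_ge:
  assumes "1 \<le> a"
    and "\<And>\<phi>. \<phi> \<in> test_functions V \<Longrightarrow>
      \<exists>F. meromorphic_continuation (local_zeta f \<phi>) {s. Re s > - (1 / real a)} F"
    and "W \<subseteq> V"
  shows "m0 f W \<ge> ereal (1 / real a)"
  unfolding m0_def
proof (rule INF_greatest)
  fix \<phi> assume "\<phi> \<in> test_functions W"
  then have "\<phi> \<in> test_functions V"
    using assms(3) unfolding test_functions_def by blast
  then obtain F where "meromorphic_continuation (local_zeta f \<phi>) {s. Re s > - (1 / real a)} F"
    using assms(2) by blast
  moreover have "1 / real a > 0" using assms(1) by simp
  ultimately show "ereal (1 / real a) \<le> m0_at f \<phi>"
    unfolding m0_at_def by (intro Sup_upper) blast
qed

theorem theorem3p3: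
  fixes a b :: nat
    and U :: "(real \<times> real) set"
    and f v h :: "real \<times> real \<Rightarrow> real"
    and hj :: "nat \<Rightarrow> real \<Rightarrow> real"
  assumes "1 \<le> a" and "a \<le> b"
    and "open U" and "(0, 0) \<in> U"
    and "smooth_on U f"
    and "\<And>x y. (x, y) \<in> U \<Longrightarrow> f (x, y) = v (x, y) * x ^ a * y ^ b + h (x, y)"
    and "\<And>x y. (x, y) \<in> U \<Longrightarrow> h (x, y) = (\<Sum>j<a. x ^ j * hj j y)"
    and "smooth_on U v" and "v (0, 0) > 0"
    and "\<And>j. j < a \<Longrightarrow> smooth_on (snd ` U) (hj j)"
    and "\<And>j. j < a \<Longrightarrow> flat_at_origin (hj j)"
    and "\<exists>p\<in>U. h p \<noteq> 0"
  shows "\<exists>V. open V \<and> (0, 0) \<in> V \<and> V \<subseteq> U \<and>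
    (\<forall>\<phi>\<in>test_functions V.
       (\<forall>s. Re s > 0 \<longrightarrow> integrable lborel (zeta_integrand f \<phi> s)) \<and>
       local_zeta f \<phi> holomorphic_on {s. Re s > 0} \<and>
       (\<exists>F. meromorphic_continuation (local_zeta f \<phi>) {s. Re s > - (1 / real a)} F \<and>
          (a < b \<longrightarrow>
             {s. Re s > - (1 / real a) \<and> is_pole F s} \<subseteq>
             {- complex_of_real (real k / real b) | k :: nat.
                1 \<le> k \<and> real k < real b / real a}))) \<and>
    (\<forall>W. open W \<longrightarrow> (0, 0) \<in> W \<longrightarrow> W \<subseteq> V \<longrightarrow> m0 f W \<ge> ereal (1 / real a))"
proof -
  define g where "g p = v p * fst p ^ a * snd p ^ b" for p
  have f_eq: "f (x, y) = v (x, y) * x ^ a * y ^ b + (\<Sum>j<a. x ^ j * hj j y)" if "(x, y) \<in> U" for x y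
    using assms(6,7)[OF that] by simp
  have cont: "continuous_on U f" "continuous_on U v" "continuous_on U g"
    using smooth_on_imp_continuous_on[OF assms(5)] smooth_on_imp_continuous_on[OF assms(8)]
    unfolding g_def by (auto intro!: continuous_intros)
  have hj_0: "hj j 0 = 0" if "j < a" for j
    using assms(11)[OF that] unfolding flat_at_origin_def by (metis dir_derivs.simps(1))
  have zero: "f (0, 0) = 0" "g (0, 0) = 0"
    using f_eq[OF assms(4)] hj_0 assms(1) by (simp_all add: g_def)
  obtain c r1 where "c > 0" "r1 > 0" and bound:
    "\<forall>r\<le>r1. \<forall>g :: real \<times> real \<Rightarrow> real. \<forall>h :: nat \<Rightarrow> real \<Rightarrow> real.
    (\<forall>x y. (x, y) \<in> square r \<longrightarrow> g (x, y) = v (x, y) * x ^ a * y ^ b + (\<Sum>j<a. x ^ j * h j y)) \<longrightarrow>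
    x_derivative_bound r a b c g"
    using ex_x_derivative_bound[OF assms(3,4,8,9), of a b] by blast
  \<comment> \<open>Both functions vanish at the origin, so near it they are bounded by \<open>1\<close> and their powers are monotone in the exponent.\<close>
  define T where "T = (U \<inter> v -` {0<..}) \<inter> ((U \<inter> f -` {-1<..<1}) \<inter> (U \<inter> g -` {-1<..<1}))"
  have "open T"
    unfolding T_def using cont assms(3) by (intro open_Int continuous_open_preimage) auto
  moreover have "(0, 0) \<in> T" using assms(4,9) zero by (simp add: T_def)
  ultimately obtain r2 where "r2 > 0" and r2: "square r2 \<subseteq> T"
    using ex_square_subset by blast
  \<comment> \<open>Halving \<open>r2\<close> leaves room for the closed interval on which the flat functions are bounded.\<close>
  define r where "r = min r1 (r2 / 2)"
  have r: "0 < r" "r \<le> r1" "r < r2"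
    using \<open>r1 > 0\<close> \<open>r2 > 0\<close> by (auto simp: r_def)
  have sub: "square r \<subseteq> T" using r2 square_mono[of r r2] r by auto
  then have subU: "square r \<subseteq> U" by (auto simp: T_def)
  have small: "0 < v p" "\<bar>f p\<bar> \<le> 1" "\<bar>g p\<bar> \<le> 1" if "p \<in> square r" for p
    using that sub by (auto simp: T_def abs_le_iff)
  have interval: "{-r..r} \<subseteq> snd ` U"
  proof
    fix y assume "y \<in> {-r..r}"
    then have "(0, y) \<in> square r2" using r by (auto simp: mem_square_iff)
    then have "(0, y) \<in> U" using r2 by (auto simp: T_def)
    then show "y \<in> snd ` U" by force
  qed
  have flat: "\<exists>C. \<forall>p\<in>square r. \<bar>f p - g p\<bar> \<le> C * \<bar>snd p\<bar> ^ n" for n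
  proof -
    obtain C where C: "\<forall>(x, y)\<in>square r. \<bar>\<Sum>j<a. x ^ j * hj j y\<bar> \<le> C * \<bar>y\<bar> ^ n"
      using flat_perturbation_bound[of a "snd ` U" hj r n, OF assms(10,11) interval] by blast
    have "f (x, y) - g (x, y) = (\<Sum>j<a. x ^ j * hj j y)" if "(x, y) \<in> square r" for x y
      using f_eq[of x y] that subU by (auto simp: g_def)
    then show ?thesis using C by (intro exI[of _ C]) auto
  qed
  have f_bound: "x_derivative_bound r a b c f"
    by (rule bound[rule_format, of r f hj]) (use r f_eq subU in auto)
  have g_bound: "x_derivative_bound r a b c g"
    by (rule bound[rule_format, of r g "\<lambda>_ _. 0"]) (use r in \<open>auto simp: g_def\<close>)
  have "1 \<le> b" using assms(1,2) by simp
  have v_smooth: "smooth_on (square r) v" by (rule smooth_on_subset[OF assms(8) subU])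
  have f_cont: "continuous_on (square r) f" by (rule continuous_on_subset[OF cont(1) subU])
  have continuation: "\<exists>F. meromorphic_continuation (local_zeta f \<phi>) {s. Re s > - (1 / real a)} F \<and>
      (\<forall>s. Re s > - (1 / real a) \<and> is_pole F s \<longrightarrow>
        (\<exists>k. 1 \<le> k \<and> real k < real b / real a \<and> s = - complex_of_real (real k / real b)))"
    if "\<phi> \<in> test_functions (square r)" for \<phi>
    using that test_functions_subset_compact_smooth
    by (intro zeta_continuation[OF assms(1) \<open>1 \<le> b\<close> r(1) \<open>c > 0\<close> v_smooth small(1)
          small(3)[unfolded g_def] g_bound[unfolded g_def[abs_def]] f_cont small(2) f_bound
          flat[unfolded g_def]]) auto
  show ?thesis
  proof (intro exI[of _ "square r"] conjI ballI allI impI)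
    show "open (square r)" by (rule open_square)
    show "(0, 0) \<in> square r" using r by (simp add: mem_square_iff)
    show "square r \<subseteq> U" by (rule subU)
    fix \<phi> assume \<phi>: "\<phi> \<in> test_functions (square r)"
    then have cs: "\<phi> \<in> compact_smooth r" using test_functions_subset_compact_smooth by blast
    show "integrable lborel (zeta_integrand f \<phi> s)" if "Re s > 0" for s
      using that by (intro integrable_zeta_integrand[OF f_cont small(2) cs]) auto
    show "local_zeta f \<phi> holomorphic_on {s. Re s > 0}"
      by (rule local_zeta_holomorphic_right_half_plane[OF f_cont small(2) cs])
    show "\<exists>F. meromorphic_continuation (local_zeta f \<phi>) {s. Re s > - (1 / real a)} F \<and>
          (a < b \<longrightarrow>
             {s. Re s > - (1 / real a) \<and> is_pole F s} \<subseteq>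
             {- complex_of_real (real k / real b) | k :: nat.
                1 \<le> k \<and> real k < real b / real a})"
      using continuation[OF \<phi>] by blast
  next
    fix W :: "(real \<times> real) set" assume "W \<subseteq> square r"
    then show "m0 f W \<ge> ereal (1 / real a)"
      by (rule m0_ge[OF assms(1), rotated]) (use continuation in blast)
  qed
qed

end
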